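(* Let $T>0$, let $(\nu,m,D)$ be a dissipative measure-valued solution of the incompressible Euler equations on $\mathbb{T}^d\times[0,T]$ with initial datum $u^0$, and let $U\in C^1(\mathbb{T}^d\times[0,T];\mathbb{R}^d)$ be a strong solution of the incompressible Euler equations with the same initial datum, $U(\cdot,0)=u^0$. Then $\nu_{x,\tau}=\delta_{U(x,\tau)}$ for almost every $(x,\tau)\in\mathbb{T}^d\times(0,T)$, and $m=0$ and $D=0$ (the latter almost everywhere on $(0,T)$).
   Context: $\mathbb{T}^d$ is the $d$-dimensional torus. The incompressible Euler equations are $\partial_t u+\operatorname{div}(u\otimes u)+\nabla p=0$, $\operatorname{div}u=0$ on $\mathbb{T}^d\times[0,T]$. A strong solution is a $C^1$ vector field satisfying these equations pointwise with some pressure $p$. A Young measure is a family $\nu=\{\nu_{x,t}\}_{(x,t)\in\mathbb{T}^d\times(0,T)}$ of probability measures on $\mathbb{R}^d$ such that $(x,t)\mapsto\int_{\mathbb{R}^d}f(z)\,d\nu_{x,t}(z)$ is Borel measurable for every bounded continuous $f$ on $\mathbb{R}^d$. Write $\langle\nu_{x,t},f\rangle:=\int_{\mathbb{R}^d}f(z)\,d\nu_{x,t}(z)$; $\operatorname{id}$ is the identity map $z\mapsto z$, $\operatorname{id}\otimes\operatorname{id}$ is $z\mapsto z\otimes z$, and $|\cdot|^2$ is $z\mapsto|z|^2$. For matrices, $A:B=\sum_{i,j}A_{ij}B_{ij}$. A dissipative measure-valued solution of the Euler equations with initial datum $u^0$ is a triple $(\nu,m,D)$ where: (i) $\nu$ is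 a Young measure; (ii) $m$ is a ($d\times d$-)matrix-valued measure on $\mathbb{T}^d\times[0,T]$ that disintegrates as $m(dx\,dt)=m_t(dx)\otimes dt$ for some family $\{m_t\}_{t\in(0,T)}$ of uniformly bounded matrix-valued measures on $\mathbb{T}^d$; (iii) $D\in L^\infty(0,T)$, $D\ge 0$, and there is a constant $C$ such that $|m_t|(\mathbb{T}^d)\le C D(t)$ for almost every $t\in[0,T]$; (iv) for almost every $\tau\in(0,T)$ and every $\phi\in C^1(\mathbb{T}^d\times[0,T];\mathbb{R}^d)$ with $\operatorname{div}\phi=0$ (divergence in $x$), $$\int_0^\tau\!\int_{\mathbb{T}^d}\partial_t\phi\cdot\langle\nu_{x,t},\operatorname{id}\rangle+\nabla\phi:\langle\nu_{x,t},\operatorname{id}\otimes\operatorname{id}\rangle\,dx\,dt+\int_0^\tau\!\int_{\mathbb{T}^d}\nabla\phi(x,t):m_t(dx)\,dt=\int_{\mathbb{T}^d}\langle\nu_{x,\tau},\operatorname{id}\rangle\cdot\phi(x,\tau)-u^0(x)\cdot\phi(x,0)\,dx;$$ (v) for every $\psi\in C^1(\mathbb{T}^d)$, $\int_{\mathbb{T}^d}\langle\nu_{x,t},\operatorname{id}\rangle\cdot\nabla\psi(x)\,dx=0$ for almost every $t\in(0,T)$; (vi) for almost every $\tau\in(0,T)$, $$\frac12\int_{\mathbb{T}^d}\langle\nu_{x,\tau},|\cdot|^2\rangle\,dx+D(\tau)\le\frac12\int_{\mathbb{T}^d}|u^0(x)|^2\,dx.$$ *)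

theory Defs
  imports "HOL-Probability.Probability"
begin

section \<open>The torus\<close>

text \<open>
  The torus is \<open>\<real>\<^sup>d / \<int>\<^sup>d\<close>, with \<open>d = CARD('d)\<close>. Differentiable functions on it are
  \<open>\<int>\<^sup>d\<close>-periodic functions on \<open>\<real>\<^sup>d\<close>. For measure-theoretic purposes (integrals, Borel sets,
  measures, families indexed by points) it is identified with the half-open unit cube,
  which contains exactly one representative of each class and whose Borel structure is
  that of the quotient. Space-time functions take pairs \<open>(x, t)\<close>.
\<close>

definition torus :: "(real ^ 'd) set" where
  "torus = {x. \<forall>i. 0 \<le> x $ i \<and> x $ i < 1}"

definition periodic :: "(real ^ 'd \<Rightarrow> 'b) \<Rightarrow> bool" where
  "periodic f \<longleftrightarrow> (\<forall>x i. f (x + axis i 1) = f x)"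

text \<open>
  At points of \<open>S\<close> that are not interior the derivative is taken within \<open>S\<close>; for
  \<open>S = UNIV \<times> {0..T}\<close> the time derivative is thus one-sided at \<open>0\<close> and \<open>T\<close>.
\<close>

definition C1_on :: "('a::real_normed_vector \<Rightarrow> 'b::real_normed_vector) \<Rightarrow> 'a set \<Rightarrow> bool" where
  "C1_on f S \<longleftrightarrow>
     (\<exists>f' :: 'a \<Rightarrow> 'a \<Rightarrow>\<^sub>L 'b.
        (\<forall>p\<in>S. (f has_derivative blinfun_apply (f' p)) (at p within S)) \<and> continuous_on S f')"

definition C1_torus :: "(real ^ 'd \<Rightarrow> real) \<Rightarrow> bool" where
  "C1_torus \<psi> \<longleftrightarrow> periodic \<psi> \<and> C1_on \<psi> UNIV"

definition C1_torus_time ::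
    "real \<Rightarrow> ((real ^ 'd) \<times> real \<Rightarrow> real ^ 'd) \<Rightarrow> bool" where
  "C1_torus_time T \<phi> \<longleftrightarrow>
     (\<forall>t\<in>{0..T}. periodic (\<lambda>x. \<phi> (x, t))) \<and> C1_on \<phi> (UNIV \<times> {0..T})"

section \<open>Differential operators\<close>

definition dt :: "real \<Rightarrow> ((real ^ 'd) \<times> real \<Rightarrow> real ^ 'd) \<Rightarrow> (real ^ 'd) \<times> real \<Rightarrow> real ^ 'd" where
  "dt T \<phi> = (\<lambda>(x, t). vector_derivative (\<lambda>s. \<phi> (x, s)) (at t within {0..T}))"

text \<open>Row \<open>i\<close>, column \<open>j\<close> of \<open>jacobian F (at x)\<close> is the \<open>j\<close>-th partial derivative of \<open>F\<^sub>i\<close>.\<close>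

definition grad_x :: "((real ^ 'd) \<times> real \<Rightarrow> real ^ 'd) \<Rightarrow> (real ^ 'd) \<times> real \<Rightarrow> real ^ 'd ^ 'd" where
  "grad_x \<phi> = (\<lambda>(x, t). jacobian (\<lambda>y. \<phi> (y, t)) (at x))"

definition divergence :: "(real ^ 'd \<Rightarrow> real ^ 'd) \<Rightarrow> real ^ 'd \<Rightarrow> real" where
  "divergence F x = trace (jacobian F (at x))"

definition mat_divergence :: "(real ^ 'd \<Rightarrow> real ^ 'd ^ 'd) \<Rightarrow> real ^ 'd \<Rightarrow> real ^ 'd" where
  "mat_divergence A x = (\<chi> i. divergence (\<lambda>y. A y $ i) x)"

definition gradient :: "(real ^ 'd \<Rightarrow> real) \<Rightarrow> real ^ 'd \<Rightarrow> real ^ 'd" where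
  "gradient \<psi> x = (\<chi> i. frechet_derivative \<psi> (at x) (axis i 1))"

definition tensor :: "real ^ 'd \<Rightarrow> real ^ 'd \<Rightarrow> real ^ 'd ^ 'd" where
  "tensor a b = (\<chi> i j. a $ i * b $ j)"

section \<open>Strong solutions\<close>

text \<open>
  The pressure is only required to make sense of its spatial gradient; no regularity in
  time is imposed.
\<close>

definition euler_strong_solution :: "real \<Rightarrow> ((real ^ 'd) \<times> real \<Rightarrow> real ^ 'd) \<Rightarrow> bool" where
  "euler_strong_solution T U \<longleftrightarrow>
     C1_torus_time T U \<and>
     (\<exists>p :: (real ^ 'd) \<times> real \<Rightarrow> real.
        (\<forall>t\<in>{0..T}. periodic (\<lambda>x. p (x, t)) \<and> (\<lambda>x. p (x, t)) differentiable_on UNIV) \<and>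
        (\<forall>t\<in>{0..T}. \<forall>x.
           dt T U (x, t) + mat_divergence (\<lambda>y. tensor (U (y, t)) (U (y, t))) x
             + gradient (\<lambda>y. p (y, t)) x = 0)) \<and>
     (\<forall>t\<in>{0..T}. \<forall>x. divergence (\<lambda>y. U (y, t)) x = 0)"

section \<open>Vector-valued measures\<close>

text \<open>A vector-valued measure is a countably additive set function on the measurable sets of \<open>M\<close>.\<close>

definition vector_measure :: "'a measure \<Rightarrow> ('a set \<Rightarrow> 'b::real_normed_vector) \<Rightarrow> bool" where
  "vector_measure M \<mu> \<longleftrightarrow>
     \<mu> {} = 0 \<and>
     (\<forall>A :: nat \<Rightarrow> 'a set. range A \<subseteq> sets M \<longrightarrow> disjoint_family A \<longrightarrow>
        (\<lambda>n. \<mu> (A n)) sums \<mu> (\<Union>n. A n))"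

text \<open>
  Total variation of the whole space. For matrices \<open>norm\<close> is the Frobenius norm.
\<close>

definition total_variation :: "'a measure \<Rightarrow> ('a set \<Rightarrow> 'b::real_normed_vector) \<Rightarrow> ennreal" where
  "total_variation M \<mu> =
     (SUP P\<in>{P. finite P \<and> P \<subseteq> sets M \<and> partition_on (space M) P}. \<Sum>A\<in>P. ennreal (norm (\<mu> A)))"

text \<open>
  The positive part in the Jordan decomposition of a signed measure. Since \<open>ennreal\<close>
  truncates negative values to \<open>0 = \<mu> {}\<close>, the supremum is that of \<open>\<mu> B\<close> over measurable
  \<open>B \<subseteq> A\<close>.
\<close>

definition positive_variation :: "'a measure \<Rightarrow> ('a set \<Rightarrow> real) \<Rightarrow> 'a measure" where
  "positive_variation M \<mu> =
     measure_of (space M) (sets M) (\<lambda>A. SUP B\<in>{B \<in> sets M. B \<subseteq> A}. ennreal (\<mu> B))"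

definition signed_integral :: "'a measure \<Rightarrow> ('a set \<Rightarrow> real) \<Rightarrow> ('a \<Rightarrow> real) \<Rightarrow> real" where
  "signed_integral M \<mu> f =
     integral\<^sup>L (positive_variation M \<mu>) f - integral\<^sup>L (positive_variation M (\<lambda>A. - \<mu> A)) f"

text \<open>The integral of \<open>G : d\<mu>\<close>, the sum over \<open>i, j\<close> of the integrals of \<open>G\<^sub>i\<^sub>j d\<mu>\<^sub>i\<^sub>j\<close>.\<close>

definition matrix_integral ::
    "'a measure \<Rightarrow> ('a set \<Rightarrow> real ^ 'd ^ 'd) \<Rightarrow> ('a \<Rightarrow> real ^ 'd ^ 'd) \<Rightarrow> real" where
  "matrix_integral M \<mu> G =
     (\<Sum>i\<in>UNIV. \<Sum>j\<in>UNIV. signed_integral M (\<lambda>A. \<mu> A $ i $ j) (\<lambda>x. G x $ i $ j))"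

abbreviation borel_torus :: "(real ^ 'd) measure" where
  "borel_torus \<equiv> restrict_space borel torus"

abbreviation borel_torus_time :: "real \<Rightarrow> ((real ^ 'd) \<times> real) measure" where
  "borel_torus_time T \<equiv> restrict_space borel (torus \<times> {0..T})"

text \<open>
  \<open>m(dx dt) = m\<^sub>t(dx) \<otimes> dt\<close>, with \<open>t\<close>-measurability and integrability of
  \<open>t \<mapsto> m\<^sub>t {x. (x, t) \<in> E}\<close> included, for a uniformly bounded family of measures.
\<close>

definition disintegrates ::
    "real \<Rightarrow> (((real ^ 'd) \<times> real) set \<Rightarrow> real ^ 'd ^ 'd) \<Rightarrow>
     (real \<Rightarrow> (real ^ 'd) set \<Rightarrow> real ^ 'd ^ 'd) \<Rightarrow> bool" where
  "disintegrates T m mt \<longleftrightarrow>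
     (\<forall>t\<in>{0<..<T}. vector_measure borel_torus (mt t)) \<and>
     (\<exists>K :: real. \<forall>t\<in>{0<..<T}. total_variation borel_torus (mt t) \<le> ennreal K) \<and>
     (\<forall>E\<in>sets (borel_torus_time T).
        has_bochner_integral (lebesgue_on {0<..<T}) (\<lambda>t. mt t ((\<lambda>x. (x, t)) -` E)) (m E))"

section \<open>Young measures and dissipative measure-valued solutions\<close>

text \<open>Only the values of \<open>\<nu>\<close> at points of \<open>torus \<times> {0<..<T}\<close> matter.\<close>

definition young_measure :: "real \<Rightarrow> ((real ^ 'd) \<times> real \<Rightarrow> (real ^ 'd) measure) \<Rightarrow> bool" where
  "young_measure T \<nu> \<longleftrightarrow>
     (\<forall>p\<in>torus \<times> {0<..<T}. prob_space (\<nu> p) \<and> sets (\<nu> p) = sets borel) \<and>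
     (\<forall>f :: real ^ 'd \<Rightarrow> real. continuous_on UNIV f \<longrightarrow> bounded (range f) \<longrightarrow>
        (\<lambda>p. integral\<^sup>L (\<nu> p) f) \<in> borel_measurable (restrict_space borel (torus \<times> {0<..<T})))"

text \<open>
  The energy inequality is stated with extended nonnegative integrals, so that it entails
  finiteness of the second moments of \<open>\<nu>\<close> almost everywhere (whenever \<open>u0\<close> is square
  integrable); hence the Bochner integrals in the momentum and divergence conditions exist
  and do not take their default value \<open>0\<close>. On matrices \<open>A \<bullet> B\<close> is \<open>A : B\<close>.
\<close>

definition dissipative_mv_solution ::
    "real \<Rightarrow> (real ^ 'd \<Rightarrow> real ^ 'd) \<Rightarrow> ((real ^ 'd) \<times> real \<Rightarrow> (real ^ 'd) measure) \<Rightarrow>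
     (((real ^ 'd) \<times> real) set \<Rightarrow> real ^ 'd ^ 'd) \<Rightarrow> (real \<Rightarrow> real) \<Rightarrow> bool" where
  "dissipative_mv_solution T u0 \<nu> m D \<longleftrightarrow>
     young_measure T \<nu> \<and>
     vector_measure (borel_torus_time T) m \<and>
     D \<in> borel_measurable (lebesgue_on {0<..<T}) \<and>
     (\<exists>K. AE t in lebesgue_on {0<..<T}. \<bar>D t\<bar> \<le> K) \<and>
     (AE t in lebesgue_on {0<..<T}. 0 \<le> D t) \<and>
     (\<exists>mt.
        disintegrates T m mt \<and>
        (\<exists>C\<ge>0. AE t in lebesgue_on {0<..<T}.
           total_variation borel_torus (mt t) \<le> ennreal (C * D t)) \<and>
        (AE \<tau> in lebesgue_on {0<..<T}. \<forall>\<phi>.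
           C1_torus_time T \<phi> \<longrightarrow>
           (\<forall>t\<in>{0..T}. \<forall>x. divergence (\<lambda>y. \<phi> (y, t)) x = 0) \<longrightarrow>
           (LINT t|lebesgue_on {0<..<\<tau>}. LINT x|lebesgue_on torus.
              dt T \<phi> (x, t) \<bullet> (LINT z|\<nu> (x, t). z)
              + grad_x \<phi> (x, t) \<bullet> (LINT z|\<nu> (x, t). tensor z z))
           + (LINT t|lebesgue_on {0<..<\<tau>}. matrix_integral borel_torus (mt t) (\<lambda>x. grad_x \<phi> (x, t)))
           = (LINT x|lebesgue_on torus.
                (LINT z|\<nu> (x, \<tau>). z) \<bullet> \<phi> (x, \<tau>) - u0 x \<bullet> \<phi> (x, 0)))) \<and>
     (\<forall>\<psi>. C1_torus \<psi> \<longrightarrow>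
        (AE t in lebesgue_on {0<..<T}.
           (LINT x|lebesgue_on torus. (LINT z|\<nu> (x, t). z) \<bullet> gradient \<psi> x) = 0)) \<and>
     (AE \<tau> in lebesgue_on {0<..<T}.
        (\<integral>\<^sup>+ x. (\<integral>\<^sup>+ z. ennreal ((norm z)\<^sup>2) \<partial>\<nu> (x, \<tau>)) \<partial>lebesgue_on torus) / 2 + ennreal (D \<tau>)
        \<le> (\<integral>\<^sup>+ x. ennreal ((norm (u0 x))\<^sup>2) \<partial>lebesgue_on torus) / 2)"

end

theory Submission
  imports Defs
begin

text \<open>
  The proof is a Gronwall argument for the relative energy
  \<open>e(\<tau>) = 1/2 \<integral> \<langle>\<nu>\<^sub>x\<^sub>,\<^sub>\<tau>, |z - U(x,\<tau>)|\<^sup>2\<rangle> dx + D(\<tau>)\<close>. If it vanishes for almost every time, then \<open>D = 0\<close>, the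
  total variation of \<open>m\<^sub>t\<close> is zero since it is at most \<open>C D(t)\<close>, and \<open>\<nu>\<close> has no variance about \<open>U\<close>, so that
  it is the Dirac measure at \<open>U\<close>.

  To bound \<open>e\<close>, expand the square. The second moment of \<open>\<nu>\<close> together with \<open>D\<close> is controlled by the
  energy inequality, the mixed term \<open>\<integral> \<langle>\<nu>, z\<rangle> \<bullet> U dx\<close> is given by the momentum equation tested with
  \<open>\<phi> = U\<close>, and the kinetic energy of \<open>U\<close> is integrated in time from \<open>U \<bullet> \<partial>\<^sub>tU\<close>
  (\<open>kinetic_energy_difference\<close>). With \<open>H = \<integral> U \<bullet> \<partial>\<^sub>tU dx\<close> and
  \<open>G = \<integral> \<partial>\<^sub>tU \<bullet> \<langle>\<nu>, z\<rangle> + \<nabla>U : \<langle>\<nu>, z \<otimes> z\<rangle> dx\<close> this yields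
  \<open>e(\<tau>) \<le> - \<integral>\<^sub>0\<^sup>\<tau> (G - H) dt - \<integral>\<^sub>0\<^sup>\<tau> \<integral> \<nabla>U : dm\<^sub>t dt\<close>.

  The Euler equation \<open>\<partial>\<^sub>tU = - (\<nabla>U) U - \<nabla>p\<close> turns \<open>G - H\<close> into
  \<open>\<integral> \<langle>\<nu>, \<nabla>U : (z - U) \<otimes> (z - U)\<rangle> dx - \<integral> \<langle>\<nu>, z\<rangle> \<bullet> \<nabla>(p - |U|\<^sup>2/2) dx + \<integral> U \<bullet> \<nabla>p dx\<close>.
  The last integral is zero because \<open>U\<close> is divergence free
  (\<open>integral_torus_divergence_free_gradient\<close>), and the one before it because \<open>\<langle>\<nu>, z\<rangle>\<close> is weakly
  divergence free. The latter property holds for each fixed test function outside a null set of times that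
  depends on it, whereas here the test function moves with time;
  \<open>AE_integral_orthogonal_at_time\<close> closes this gap by means of rational times and continuity. What remains is
  quadratic in \<open>z - U\<close>, hence bounded by the sup norm of \<open>\<nabla>U\<close> times \<open>e\<close>
  (\<open>abs_momentum_flux_diff_le\<close>), and the integral against \<open>m\<^sub>t\<close> is bounded by a constant times \<open>D \<le> e\<close>
  (\<open>abs_matrix_integral_le\<close>). So \<open>e(\<tau>) \<le> k \<integral>\<^sub>0\<^sup>\<tau> e dt\<close> for almost every \<open>\<tau>\<close>, and \<open>gronwall_AE\<close>
  gives \<open>e = 0\<close>.
\<close>

section \<open>Lebesgue integrals over Borel sets\<close>

text \<open>
  Passing between the completed measure, in which the solution concept is stated, and the Borel product
  measures, for which Fubini's theorem is available.
\<close>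

lemma integral_lebesgue_on_borel:
  fixes g :: "'a::euclidean_space \<Rightarrow> 'b::{banach, second_countable_topology}"
  assumes "A \<in> sets borel" and "g \<in> borel_measurable (restrict_space borel A)"
  shows "integral\<^sup>L (lebesgue_on A) g = (LINT x|lborel. indicator A x *\<^sub>R g x)"
proof -
  have m: "(\<lambda>x. indicator A x *\<^sub>R g x) \<in> borel_measurable lborel"
    using assms by (simp add: borel_measurable_restrict_space_iff)
  have "integral\<^sup>L (lebesgue_on A) g = (LINT x|lebesgue. indicator A x *\<^sub>R g x)"
    using assms(1) by (intro integral_restrict_space) auto
  also have "\<dots> = (LINT x|lborel. indicator A x *\<^sub>R g x)"
    using m by (rule integral_completion)
  finally show ?thesis .
qed

lemma borel_imp_lebesgue_on:
  assumes "g \<in> measurable (restrict_space borel A) N"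
  shows "g \<in> measurable (lebesgue_on A) N"
proof -
  have "(\<lambda>x. x) \<in> measurable (lebesgue_on A) (restrict_space borel A)"
    by (rule measurable_restrict_space3) (auto simp: measurable_def)
  from measurable_comp[OF this assms] show ?thesis by (simp add: comp_def)
qed

lemma measurable_section_fst:
  fixes A :: "'a::second_countable_topology set" and B :: "'b::second_countable_topology set"
  assumes "g \<in> measurable (restrict_space borel (A \<times> B)) N" "t \<in> B"
  shows "(\<lambda>x. g (x, t)) \<in> measurable (restrict_space borel A) N"
proof -
  have "(\<lambda>x. (x, t)) \<in> measurable (restrict_space borel A) (restrict_space borel (A \<times> B))"
    using assms(2) by (intro measurable_restrict_space3) auto
  from measurable_comp[OF this assms(1)] show ?thesis by (simp add: comp_def)
qed

lemma measurable_section_snd: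
  fixes A :: "'a::second_countable_topology set" and B :: "'b::second_countable_topology set"
  assumes "g \<in> measurable (restrict_space borel (A \<times> B)) N" "x \<in> A"
  shows "(\<lambda>t. g (x, t)) \<in> measurable (restrict_space borel B) N"
proof -
  have "(\<lambda>t. (x, t)) \<in> measurable (restrict_space borel B) (restrict_space borel (A \<times> B))"
    using assms(2) by (intro measurable_restrict_space3) auto
  from measurable_comp[OF this assms(1)] show ?thesis by (simp add: comp_def)
qed

text \<open>
  Extending the integrand by zero to the whole product space reduces measurability in the parameter to the
  case of \<open>lborel\<close>.
\<close>

lemma borel_measurable_integral_section:
  fixes g :: "'a::euclidean_space \<times> 'b::euclidean_space \<Rightarrow> 'c::{banach, second_countable_topology}"
  assumes [measurable]: "A \<in> sets borel" "B \<in> sets borel"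
    and g: "g \<in> borel_measurable (restrict_space borel (A \<times> B))"
  shows "(\<lambda>t. LINT x|lebesgue_on A. g (x, t)) \<in> borel_measurable (restrict_space borel B)"
proof -
  have AB: "A \<times> B \<in> sets borel"
    using assms by (simp add: borel_Times)
  define G where "G = (\<lambda>p. indicator (A \<times> B) p *\<^sub>R g p)"
  have "G \<in> borel_measurable borel"
    unfolding G_def using g AB by (simp add: borel_measurable_restrict_space_iff)
  then have [measurable]: "G \<in> borel_measurable (borel \<Otimes>\<^sub>M borel)"
    by (simp add: borel_prod)
  have "(\<lambda>t. LINT x|lborel. G (x, t)) \<in> borel_measurable borel"
    by measurable
  then have "(\<lambda>t. LINT x|lborel. G (x, t)) \<in> borel_measurable (restrict_space borel B)"
    by (rule measurable_restrict_space1)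
  moreover have "(LINT x|lebesgue_on A. g (x, t)) = (LINT x|lborel. G (x, t))" if "t \<in> B" for t
    using that
    by (simp add: integral_lebesgue_on_borel[OF assms(1) measurable_section_fst[OF g]] G_def
        indicator_times)
  ultimately show ?thesis
    by (subst measurable_cong) (auto simp: space_restrict_space)
qed

text \<open>
  A bounded function on a set of finite volume is integrable, so Fubini's theorem applies to its extension by
  zero, the product of two Borel Lebesgue measures being again \<open>lborel\<close>.
\<close>

lemma integral_lebesgue_on_swap:
  fixes g :: "'a::euclidean_space \<times> 'b::euclidean_space \<Rightarrow> 'c::{banach, second_countable_topology}"
  assumes [measurable]: "A \<in> sets borel" "B \<in> sets borel"
    and fin: "emeasure lborel A < \<infinity>" "emeasure lborel B < \<infinity>"
    and g: "g \<in> borel_measurable (restrict_space borel (A \<times> B))"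
    and bound: "\<And>x t. x \<in> A \<Longrightarrow> t \<in> B \<Longrightarrow> norm (g (x, t)) \<le> K"
  shows "(LINT x|lebesgue_on A. LINT t|lebesgue_on B. g (x, t))
       = (LINT t|lebesgue_on B. LINT x|lebesgue_on A. g (x, t))"
proof -
  have AB: "A \<times> B \<in> sets borel"
    using assms by (simp add: borel_Times)
  define G where "G = (\<lambda>p. indicator (A \<times> B) p *\<^sub>R g p)"
  have Gb: "G \<in> borel_measurable borel"
    unfolding G_def using g AB by (simp add: borel_measurable_restrict_space_iff)
  then have Gm[measurable]: "G \<in> borel_measurable (lborel \<Otimes>\<^sub>M lborel)"
    by (simp add: lborel_prod)
  have "emeasure (lborel \<Otimes>\<^sub>M lborel) (A \<times> B) = emeasure lborel A * emeasure lborel B"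
    by (rule lborel.emeasure_pair_measure_Times) auto
  then have eAB: "emeasure (lborel :: ('a \<times> 'b) measure) (A \<times> B) < \<infinity>"
    using fin by (simp add: lborel_prod ennreal_mult_less_top)
  have "integrable lborel G"
    using AB eAB Gb bound
    by (intro integrableI_bounded_set[where A = "A \<times> B" and B = K]) (auto simp: G_def)
  then have int: "integrable (lborel \<Otimes>\<^sub>M lborel) (\<lambda>(x, t). G (x, t))"
    by (simp add: lborel_prod)
  have G1: "indicator A x *\<^sub>R (LINT t|lebesgue_on B. g (x, t)) = (LINT t|lborel. G (x, t))" for x
  proof (cases "x \<in> A")
    case True
    then show ?thesis
      by (simp add: integral_lebesgue_on_borel[OF assms(2) measurable_section_snd[OF g]] G_def
          indicator_times)
  qed (simp add: G_def)
  have G2: "indicator B t *\<^sub>R (LINT x|lebesgue_on A. g (x, t)) = (LINT x|lborel. G (x, t))" for t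
  proof (cases "t \<in> B")
    case True
    then show ?thesis
      by (simp add: integral_lebesgue_on_borel[OF assms(1) measurable_section_fst[OF g]] G_def
          indicator_times)
  qed (simp add: G_def)
  have "(LINT x|lebesgue_on A. LINT t|lebesgue_on B. g (x, t))
      = (LINT x|lebesgue. indicator A x *\<^sub>R (LINT t|lebesgue_on B. g (x, t)))"
    by (intro integral_restrict_space) auto
  also have "\<dots> = (LINT x|lebesgue. LINT t|lborel. G (x, t))"
    by (simp only: G1)
  also have "\<dots> = (LINT x|lborel. LINT t|lborel. G (x, t))"
    by (rule integral_completion) measurable
  also have "\<dots> = (LINT t|lborel. LINT x|lborel. G (x, t))"
    by (rule lborel_pair.Fubini_integral[OF int, symmetric])
  also have "\<dots> = (LINT t|lebesgue. LINT x|lborel. G (x, t))"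
    by (rule integral_completion[symmetric]) measurable
  also have "\<dots> = (LINT t|lebesgue. indicator B t *\<^sub>R (LINT x|lebesgue_on A. g (x, t)))"
    by (simp only: G2)
  also have "\<dots> = (LINT t|lebesgue_on B. LINT x|lebesgue_on A. g (x, t))"
    by (intro integral_restrict_space[symmetric]) auto
  finally show ?thesis .
qed

text \<open>
  Measurability of the exceptional set is what allows Tonelli's theorem to glue the null sets of the slices to
  a null set of the product.
\<close>

lemma AE_lebesgue_on_Times:
  fixes A :: "'a::euclidean_space set" and B :: "'b::euclidean_space set"
  assumes [measurable]: "A \<in> sets borel" "B \<in> sets borel"
    and Q: "{p \<in> A \<times> B. \<not> P p} \<in> sets borel"
    and ae: "AE t in lebesgue_on B. AE x in lebesgue_on A. P (x, t)"
  shows "AE p in lebesgue_on (A \<times> B). P p"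
proof -
  define N where "N = {p \<in> A \<times> B. \<not> P p}"
  have Nb: "N \<in> sets borel" using Q by (simp add: N_def)
  then have [measurable]: "N \<in> sets (lborel \<Otimes>\<^sub>M lborel)"
    by (simp only: lborel_prod sets_lborel)
  have "AE t in lborel. (\<integral>\<^sup>+ x. indicator N (x, t) \<partial>lborel) = (0::ennreal)"
  proof -
    have "AE t in lborel. t \<in> B \<longrightarrow> (AE x in lborel. x \<in> A \<longrightarrow> P (x, t))"
      using ae by (simp add: AE_restrict_space_iff AE_completion_iff)
    then show ?thesis
    proof (eventually_elim)
      case (elim t)
      show ?case
      proof (cases "t \<in> B")
        case True
        with elim have "AE x in lborel. x \<in> A \<longrightarrow> P (x, t)" by simp
        then have "AE x in lborel. indicator N (x, t) = (0::ennreal)"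
          by eventually_elim (auto simp: N_def)
        then have "(\<integral>\<^sup>+ x. indicator N (x, t) \<partial>lborel) = (\<integral>\<^sup>+ x. (0::ennreal) \<partial>(lborel :: 'a measure))"
          by (intro nn_integral_cong_AE)
        then show ?thesis by simp
      qed (simp add: N_def)
    qed
  qed
  then have "(\<integral>\<^sup>+ t. \<integral>\<^sup>+ x. indicator N (x, t) \<partial>lborel \<partial>lborel) = (\<integral>\<^sup>+ t. (0::ennreal) \<partial>(lborel :: 'b measure))"
    by (intro nn_integral_cong_AE)
  also have "(\<integral>\<^sup>+ t. \<integral>\<^sup>+ x. indicator N (x, t) \<partial>lborel \<partial>lborel)
      = (\<integral>\<^sup>+ p. indicator N p \<partial>(lborel \<Otimes>\<^sub>M lborel))"
    by (rule lborel_pair.nn_integral_snd) measurable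
  finally have "N \<in> null_sets lborel"
    using Nb by (simp add: lborel_prod null_sets_def)
  then have "AE p in lborel. p \<notin> N" by (rule AE_not_in)
  then have "AE p in lebesgue. p \<notin> N" by (rule AE_completion)
  then have "AE p in lebesgue. p \<in> A \<times> B \<longrightarrow> P p"
    by eventually_elim (auto simp: N_def)
  moreover have "A \<times> B \<in> sets borel"
    by (simp add: borel_Times)
  ultimately show ?thesis
    by (subst AE_restrict_space_iff) auto
qed

lemma eq_return_if_AE_eq:
  assumes "prob_space M" and sets: "sets M = sets borel" and ae: "AE z in M. z = (c::'a::t1_space)"
  shows "M = return borel c"
proof (rule measure_eqI)
  fix A assume A: "A \<in> sets M"
  interpret prob_space M by fact
  show "emeasure M A = emeasure (return borel c) A"
  proof (cases "c \<in> A")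
    case True
    with ae have "AE z in M. z \<in> A" by auto
    then have "emeasure M A = 1" using A emeasure_eq_1_AE by auto
    with True A sets show ?thesis by simp
  next
    case False
    with ae have "AE z in M. z \<notin> A" by auto
    then have "emeasure M A = 0" using AE_iff_null_sets[OF A] by (blast dest: null_setsD1)
    with False A sets show ?thesis by simp
  qed
qed (simp add: sets)

lemma integral_FTC_lebesgue_on:
  fixes F f :: "real \<Rightarrow> real"
  assumes "a \<le> b"
    and "\<And>x. a \<le> x \<Longrightarrow> x \<le> b \<Longrightarrow> (F has_vector_derivative f x) (at x within {a..b})"
    and cont: "continuous_on {a..b} f"
  shows "(LINT t|lebesgue_on {a<..<b}. f t) = F b - F a"
proof -
  have m: "f \<in> borel_measurable (restrict_space borel {a<..<b})"
    using cont by (intro borel_measurable_continuous_on_restrict) (auto intro: continuous_on_subset)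
  have ne: "AE x in lborel. x \<noteq> a \<and> x \<noteq> b"
    using AE_lborel_singleton[of a] AE_lborel_singleton[of b] by eventually_elim auto
  have m1: "(\<lambda>x. indicator {a<..<b} x *\<^sub>R f x) \<in> borel_measurable lborel"
    using m by (simp add: borel_measurable_restrict_space_iff)
  have m2: "(\<lambda>x. indicator {a..b} x *\<^sub>R f x) \<in> borel_measurable lborel"
    using borel_measurable_continuous_on_indicator[OF _ cont] by simp
  have "(LINT t|lebesgue_on {a<..<b}. f t) = (LINT t|lborel. indicator {a<..<b} t *\<^sub>R f t)"
    using m by (intro integral_lebesgue_on_borel) auto
  also have "\<dots> = (LINT t|lborel. indicator {a..b} t *\<^sub>R f t)"
    by (rule integral_cong_AE[OF m1 m2], rule eventually_mono[OF ne]) (auto split: split_indicator)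
  also have "\<dots> = F b - F a"
    by (rule integral_FTC_atLeastAtMost) (use assms in auto)
  finally show ?thesis .
qed

lemma finite_measure_lebesgue_on_borel:
  assumes "A \<in> sets borel" "emeasure lborel A < \<infinity>"
  shows "finite_measure (lebesgue_on A)"
  using assms by (intro finite_measureI) (simp add: space_restrict_space emeasure_restrict_space)

lemma borel_measurable_lebesgue_on_subset:
  assumes "f \<in> borel_measurable (lebesgue_on A)" "B \<subseteq> A" "A \<in> sets lebesgue" "B \<in> sets lebesgue"
  shows "f \<in> borel_measurable (lebesgue_on B)"
  using measurable_restrict_mono[OF assms(1,2)] .

lemma AE_lebesgue_on_subset:
  assumes "AE x in lebesgue_on A. P x" "B \<subseteq> A" "A \<in> sets lebesgue" "B \<in> sets lebesgue"
  shows "AE x in lebesgue_on B. P x"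
proof -
  have "AE x in lebesgue. x \<in> A \<longrightarrow> P x"
    using assms by (simp add: AE_restrict_space_iff)
  then have "AE x in lebesgue. x \<in> B \<longrightarrow> P x"
    using assms(2) by (auto elim!: eventually_mono)
  then show ?thesis using assms by (simp add: AE_restrict_space_iff)
qed

section \<open>Gronwall inequality for almost every time\<close>

text \<open>
  Comparison with the weight \<open>exp (2 K t)\<close>: a bound \<open>e \<le> a exp (2 K t)\<close> inserted into the integral
  inequality improves itself to \<open>e \<le> a/2 exp (2 K t)\<close>, because the weight integrates to
  \<open>exp (2 K \<tau>) / (2 K)\<close> at most. Iterating, and discarding countably many null sets, leaves \<open>e \<le> 0\<close>.
\<close>

lemma gronwall_AE:
  fixes e :: "real \<Rightarrow> real"
  assumes K: "K > 0"
    and meas: "e \<in> borel_measurable (lebesgue_on {0<..<T})"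
    and bound: "AE t in lebesgue_on {0<..<T}. 0 \<le> e t \<and> e t \<le> c"
    and ineq: "AE \<tau> in lebesgue_on {0<..<T}. e \<tau> \<le> K * (LINT t|lebesgue_on {0<..<\<tau>}. e t)"
  shows "AE t in lebesgue_on {0<..<T}. e t = 0"
proof -
  define c' where "c' = max c 0"
  have step: "AE t in lebesgue_on {0<..<T}. e t \<le> (a / 2) * exp (2 * K * t)"
    if a: "a \<ge> 0" and ae: "AE t in lebesgue_on {0<..<T}. e t \<le> a * exp (2 * K * t)" for a
    using ineq AE_space
  proof eventually_elim
    case (elim \<tau>)
    then have \<tau>: "0 < \<tau>" "\<tau> < T" by (auto simp: space_restrict_space)
    then have sub: "{0<..<\<tau>} \<subseteq> {0<..<T}" by auto
    interpret finite_measure "lebesgue_on {0<..<\<tau>}"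
      by (rule finite_measure_lebesgue_on_borel) (use \<tau> in auto)
    have ie: "integrable (lebesgue_on {0<..<\<tau>}) e"
    proof (rule integrable_const_bound[where B = c'])
      show "e \<in> borel_measurable (lebesgue_on {0<..<\<tau>})"
        using meas sub by (rule borel_measurable_lebesgue_on_subset) auto
      show "AE x in lebesgue_on {0<..<\<tau>}. norm (e x) \<le> c'"
        by (rule eventually_mono[OF AE_lebesgue_on_subset[OF bound sub]]) (auto simp: c'_def)
    qed
    have cont: "continuous_on S (\<lambda>t. a * exp (2 * K * t))" for S
      by (intro continuous_intros)
    have ix: "integrable (lebesgue_on {0<..<\<tau>}) (\<lambda>t. a * exp (2 * K * t))"
    proof (rule integrable_const_bound[where B = "a * exp (2 * K * \<tau>)"])
      show "(\<lambda>t. a * exp (2 * K * t)) \<in> borel_measurable (lebesgue_on {0<..<\<tau>})"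
        by (intro borel_imp_lebesgue_on borel_measurable_continuous_on_restrict cont)
      show "AE x in lebesgue_on {0<..<\<tau>}. norm (a * exp (2 * K * x)) \<le> a * exp (2 * K * \<tau>)"
        by (rule eventually_mono[OF AE_space])
          (use K a in \<open>auto simp: space_restrict_space abs_mult intro!: mult_left_mono\<close>)
    qed
    have "K * (LINT t|lebesgue_on {0<..<\<tau>}. e t) \<le> K * (LINT t|lebesgue_on {0<..<\<tau>}. a * exp (2 * K * t))"
      using K AE_lebesgue_on_subset[OF ae sub]
      by (intro mult_left_mono integral_mono_AE[OF ie ix]) auto
    also have "(LINT t|lebesgue_on {0<..<\<tau>}. a * exp (2 * K * t))
        = a / (2 * K) * exp (2 * K * \<tau>) - a / (2 * K) * exp (2 * K * 0)"
    proof (rule integral_FTC_lebesgue_on)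
      fix x
      have "((\<lambda>t. a / (2 * K) * exp (2 * K * t)) has_real_derivative a * exp (2 * K * x)) (at x within {0..\<tau>})"
        using K by (auto intro!: derivative_eq_intros)
      then show "((\<lambda>t. a / (2 * K) * exp (2 * K * t)) has_vector_derivative a * exp (2 * K * x)) (at x within {0..\<tau>})"
        by (simp add: has_real_derivative_iff_has_vector_derivative)
    qed (use \<tau> cont in auto)
    also have "K * \<dots> = (a / 2) * exp (2 * K * \<tau>) - a / 2"
      using K by (simp add: field_simps)
    finally show ?case using elim(1) a by simp
  qed
  have "AE t in lebesgue_on {0<..<T}. e t \<le> (c' / 2 ^ n) * exp (2 * K * t)" for n
  proof (induction n)
    case 0
    show ?case
      using bound AE_space
    proof eventually_elim
      case (elim t)
      then have "1 \<le> exp (2 * K * t)" using K by (simp add: space_restrict_space)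
      then have "c' * 1 \<le> c' * exp (2 * K * t)"
        by (intro mult_left_mono) (auto simp: c'_def)
      with elim show ?case by (simp add: c'_def)
    qed
  next
    case (Suc n)
    from step[OF _ Suc] show ?case by (simp add: c'_def field_simps)
  qed
  then have "AE t in lebesgue_on {0<..<T}. \<forall>n. e t \<le> (c' / 2 ^ n) * exp (2 * K * t)"
    by (simp add: AE_all_countable)
  then show ?thesis
    using bound
  proof eventually_elim
    case (elim t)
    have "(\<lambda>n. (c' * exp (2 * K * t)) * (1 / 2) ^ n) \<longlonglongrightarrow> (c' * exp (2 * K * t)) * 0"
      by (intro tendsto_mult tendsto_const LIMSEQ_power_zero) simp
    then have "(\<lambda>n. (c' / 2 ^ n) * exp (2 * K * t)) \<longlonglongrightarrow> 0"
      by (simp add: power_divide)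
    from LIMSEQ_le_const[OF this] elim have "e t \<le> 0" by auto
    with elim show ?case by simp
  qed
qed

section \<open>Young measures as Markov kernels and their moments\<close>

text \<open>
  A closed set \<open>C\<close> has the measure \<open>lim\<^sub>n \<integral> max 0 (1 - n dist (z, C)) d\<nu>\<close>, a limit of integrals of bounded
  continuous functions, and the closed sets generate the Borel sets. In kernel form, measurability extends from
  bounded continuous observables to the moments of \<open>\<nu>\<close>, whose integrands are unbounded.
\<close>

lemma young_measure_kernel:
  fixes \<nu> :: "(real ^ 'd) \<times> real \<Rightarrow> (real ^ 'd) measure"
  assumes "young_measure T \<nu>"
  shows "\<nu> \<in> measurable (restrict_space borel (torus \<times> {0<..<T})) (prob_algebra borel)"
proof (rule measurable_prob_algebra_generated[where \<Omega> = UNIV and G = "Collect closed"])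
  show "sets (borel :: (real ^ 'd) measure) = sigma_sets UNIV (Collect closed)"
    by (simp add: borel_eq_closed)
  show "Int_stable (Collect (closed :: (real ^ 'd) set \<Rightarrow> bool))"
    by (auto simp: Int_stable_def)
  show prob: "prob_space (\<nu> a)" and sets: "sets (\<nu> a) = sets borel"
    if "a \<in> space (restrict_space borel (torus \<times> {0<..<T}))" for a
    using assms that by (auto simp: young_measure_def space_restrict_space)
  fix C :: "(real ^ 'd) set"
  assume "C \<in> Collect closed"
  then have C: "closed C" by simp
  show "(\<lambda>a. emeasure (\<nu> a) C) \<in> borel_measurable (restrict_space borel (torus \<times> {0<..<T}))"
  proof (cases "C = {}")
    case False
    define f where "f = (\<lambda>(n::nat) z. max 0 (1 - real n * infdist z C))"
    have cont: "continuous_on UNIV (f n)" for n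
      unfolding f_def by (intro continuous_intros)
    have f01: "0 \<le> f n z" "f n z \<le> 1" for n z
      by (auto simp: f_def infdist_nonneg)
    have lim: "(\<lambda>n. f n z) \<longlonglongrightarrow> indicator C z" for z
    proof (cases "z \<in> C")
      case True
      then show ?thesis by (simp add: f_def)
    next
      case z: False
      have pos: "infdist z C > 0"
        using C False z by (metis infdist_nonneg in_closed_iff_infdist_zero order_less_le)
      then obtain N :: nat where N: "1 < real N * infdist z C"
        using reals_Archimedean3 by blast
      have "f n z = 0" if "n \<ge> N" for n
      proof -
        have "real N * infdist z C \<le> real n * infdist z C"
          using that pos by (intro mult_right_mono) auto
        then show ?thesis using N by (simp add: f_def)
      qed
      then have "eventually (\<lambda>n. f n z = indicator C z) sequentially"
        using z by (auto simp: eventually_sequentially)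
      then show ?thesis by (rule tendsto_eventually)
    qed
    have lim_int: "(\<lambda>n. integral\<^sup>L (\<nu> a) (f n)) \<longlonglongrightarrow> measure (\<nu> a) C"
      if a: "a \<in> space (restrict_space borel (torus \<times> {0<..<T}))" for a
    proof -
      interpret prob_space "\<nu> a" by (rule prob[OF a])
      have [measurable_cong]: "sets (\<nu> a) = sets borel" by (rule sets[OF a])
      have "(\<lambda>n. integral\<^sup>L (\<nu> a) (f n)) \<longlonglongrightarrow> integral\<^sup>L (\<nu> a) (indicator C)"
      proof (rule integral_dominated_convergence[where w = "\<lambda>_. 1"])
        show "f n \<in> borel_measurable (\<nu> a)" for n
          using borel_measurable_continuous_onI[OF cont] by measurable
        have [measurable]: "C \<in> sets borel" using C by (rule borel_closed)
        show "indicator C \<in> borel_measurable (\<nu> a)"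
          by measurable
      qed (use f01 lim in auto)
      then show ?thesis using C sets[OF a] by simp
    qed
    have "(\<lambda>a. integral\<^sup>L (\<nu> a) (f n)) \<in> borel_measurable (restrict_space borel (torus \<times> {0<..<T}))" for n
    proof -
      have "bounded (range (f n))"
        using f01[of n] by (intro boundedI[where B = 1]) auto
      then show ?thesis using assms cont[of n] by (simp add: young_measure_def)
    qed
    then have "(\<lambda>a. measure (\<nu> a) C) \<in> borel_measurable (restrict_space borel (torus \<times> {0<..<T}))"
      by (rule borel_measurable_LIMSEQ_real[rotated]) (use lim_int in auto)
    then have "(\<lambda>a. ennreal (measure (\<nu> a) C)) \<in> borel_measurable (restrict_space borel (torus \<times> {0<..<T}))"
      by measurable
    then show ?thesis
      using prob by (subst measurable_cong[where g = "\<lambda>a. ennreal (measure (\<nu> a) C)"])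
        (auto intro: finite_measure.emeasure_eq_measure simp: prob_space_def)
  qed simp
qed auto

lemma inner_tensor: "A \<bullet> tensor a b = a \<bullet> (A *v b)"
  by (simp add: inner_vec_def tensor_def matrix_vector_mult_def sum_distrib_left mult.left_commute mult.commute)

lemma norm_tensor: "norm (tensor a b) = norm a * norm b"
proof -
  have "(norm (tensor a b))\<^sup>2 = (norm a * norm b)\<^sup>2"
    unfolding power_mult_distrib
    by (simp add: power2_norm_eq_inner inner_vec_def tensor_def sum_product mult.assoc mult.left_commute)
  then show ?thesis by simp
qed

lemma continuous_on_tensor [continuous_intros]:
  "continuous_on S f \<Longrightarrow> continuous_on S g \<Longrightarrow> continuous_on S (\<lambda>x. tensor (f x) (g x))"
  unfolding tensor_def by (intro continuous_intros)

lemma norm_le_one_plus_square: "norm z \<le> 1 + (norm z)\<^sup>2"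
proof -
  have "0 \<le> (norm z - 1 / 2)\<^sup>2" by simp
  then show ?thesis by (simp add: power2_diff power_divide)
qed

definition barycenter :: "(real ^ 'd) measure \<Rightarrow> real ^ 'd" where
  "barycenter M = (LINT z|M. z)"

definition second_moment :: "(real ^ 'd) measure \<Rightarrow> real ^ 'd ^ 'd" where
  "second_moment M = (LINT z|M. tensor z z)"

text \<open>
  Written in terms of moments, so that its measurability in a parameter is immediate. For a probability measure
  with finite second moment it is the integral of \<open>|z - v|\<^sup>2\<close>.
\<close>

definition variance_about :: "(real ^ 'd) measure \<Rightarrow> real ^ 'd \<Rightarrow> real" where
  "variance_about M v = (LINT z|M. (norm z)\<^sup>2) - 2 * (barycenter M \<bullet> v) + (norm v)\<^sup>2"

context
  fixes M :: "(real ^ 'd) measure"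
  assumes prob: "prob_space M" and sets [measurable_cong]: "sets M = sets borel"
    and fin: "(\<integral>\<^sup>+ z. ennreal ((norm z)\<^sup>2) \<partial>M) < \<infinity>"
begin

interpretation prob_space M by (rule prob)

lemma integrable_norm_square: "integrable M (\<lambda>z. (norm z)\<^sup>2)"
  using fin by (intro integrableI_bounded) auto

lemma integrable_identity: "integrable M (\<lambda>z. z)"
proof (rule Bochner_Integration.integrable_bound)
  show "integrable M (\<lambda>z. 1 + (norm z)\<^sup>2)"
    using integrable_norm_square by simp
  show "AE z in M. norm z \<le> norm (1 + (norm z)\<^sup>2)"
    using norm_le_one_plus_square by (intro always_eventually allI) simp
qed simp

lemma tensor_measurable: "(\<lambda>z. tensor z z) \<in> borel_measurable M"
proof -
  have "(\<lambda>z :: real ^ 'd. tensor z z) \<in> borel_measurable borel"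
    by (intro borel_measurable_continuous_onI continuous_intros)
  then show ?thesis by measurable
qed

lemma integrable_tensor: "integrable M (\<lambda>z. tensor z z)"
  by (rule Bochner_Integration.integrable_bound[OF integrable_norm_square tensor_measurable])
    (simp add: norm_tensor power2_eq_square)

lemma norm_barycenter_le: "norm (barycenter M) \<le> 1 + (LINT z|M. (norm z)\<^sup>2)"
proof -
  have "norm (barycenter M) \<le> (LINT z|M. norm z)"
    unfolding barycenter_def by (rule integral_norm_bound)
  also have "\<dots> \<le> (LINT z|M. 1 + (norm z)\<^sup>2)"
    using integrable_identity integrable_norm_square norm_le_one_plus_square by (intro integral_mono) auto
  also have "\<dots> = 1 + (LINT z|M. (norm z)\<^sup>2)"
    using integrable_norm_square by (simp add: prob_space)
  finally show ?thesis .
qed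

lemma norm_second_moment_le: "norm (second_moment M) \<le> (LINT z|M. (norm z)\<^sup>2)"
  unfolding second_moment_def
  using integral_norm_bound[of M "\<lambda>z. tensor z z"] by (simp add: norm_tensor power2_eq_square)

lemma norm_square_diff: "(norm (z - v))\<^sup>2 = (norm z)\<^sup>2 - 2 * (z \<bullet> v) + (norm v)\<^sup>2" for z v :: "real ^ 'd"
  by (simp add: power2_norm_eq_inner inner_diff_left inner_diff_right inner_commute)

lemma integrable_variance: "integrable M (\<lambda>z. (norm (z - v))\<^sup>2)"
  unfolding norm_square_diff using integrable_identity integrable_norm_square by simp

lemma variance_about_eq: "(LINT z|M. (norm (z - v))\<^sup>2) = variance_about M v"
  unfolding norm_square_diff variance_about_def barycenter_def
  using integrable_identity integrable_norm_square by (simp add: prob_space)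

lemma variance_about_nonneg: "0 \<le> variance_about M v"
  unfolding variance_about_eq[symmetric] by simp

text \<open>
  The left-hand side is the integral of \<open>A : (z - v) \<otimes> (z - v)\<close>, whose integrand is at most
  \<open>|A| |z - v|\<^sup>2\<close> by the Cauchy-Schwarz inequality for the Frobenius product.
\<close>

lemma abs_quadratic_moment_le:
  "\<bar>A \<bullet> second_moment M - barycenter M \<bullet> (A *v v) - v \<bullet> (A *v barycenter M) + v \<bullet> (A *v v)\<bar>
    \<le> norm A * variance_about M v"
proof -
  have expand: "A \<bullet> tensor (z - v) (z - v) = A \<bullet> tensor z z - z \<bullet> (A *v v) - (v v* A) \<bullet> z + v \<bullet> (A *v v)" for z
    by (simp add: inner_tensor matrix_vector_mult_diff_distrib inner_diff_left inner_diff_right dot_lmul_matrix)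
  have 1: "(LINT z|M. A \<bullet> tensor (z - v) (z - v))
      = A \<bullet> second_moment M - barycenter M \<bullet> (A *v v) - v \<bullet> (A *v barycenter M) + v \<bullet> (A *v v)"
  proof -
    have "(LINT z|M. A \<bullet> tensor (z - v) (z - v))
        = A \<bullet> second_moment M - barycenter M \<bullet> (A *v v) - (v v* A) \<bullet> barycenter M + v \<bullet> (A *v v)"
      unfolding expand second_moment_def barycenter_def
      using integrable_identity integrable_tensor by (simp add: prob_space)
    then show ?thesis by (simp add: dot_lmul_matrix)
  qed
  have "\<bar>A \<bullet> tensor w w\<bar> \<le> norm A * (norm w)\<^sup>2" for w
    using Cauchy_Schwarz_ineq2[of A "tensor w w"] by (simp add: norm_tensor power2_eq_square)
  moreover have "integrable M (\<lambda>z. A \<bullet> tensor (z - v) (z - v))"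
    unfolding expand using integrable_identity integrable_tensor by simp
  ultimately have "\<bar>LINT z|M. A \<bullet> tensor (z - v) (z - v)\<bar> \<le> (LINT z|M. norm A * (norm (z - v))\<^sup>2)"
    using integrable_variance by (intro order_trans[OF integral_abs_bound] integral_mono) auto
  also have "\<dots> = norm A * variance_about M v"
    by (simp add: variance_about_eq)
  finally show ?thesis unfolding 1 .
qed

lemma eq_return_if_variance_about_eq_0:
  assumes "variance_about M v = 0"
  shows "M = return borel v"
proof (rule eq_return_if_AE_eq[OF prob sets])
  have "AE z in M. (norm (z - v))\<^sup>2 = 0"
    using assms integrable_variance by (subst integral_nonneg_eq_0_iff_AE[symmetric]) (auto simp: variance_about_eq)
  then show "AE z in M. z = v" by simp
qed

end

lemma moments_measurable:
  fixes \<kappa> :: "'a \<Rightarrow> (real ^ 'd) measure"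
  assumes "\<kappa> \<in> measurable X (prob_algebra borel)"
  shows "(\<lambda>x. barycenter (\<kappa> x)) \<in> borel_measurable X"
    and "(\<lambda>x. second_moment (\<kappa> x)) \<in> borel_measurable X"
    and "(\<lambda>x. LINT z|\<kappa> x. (norm z)\<^sup>2) \<in> borel_measurable X"
    and "(\<lambda>x. \<integral>\<^sup>+ z. ennreal ((norm z)\<^sup>2) \<partial>\<kappa> x) \<in> borel_measurable X"
proof -
  have [measurable]: "\<kappa> \<in> measurable X (subprob_algebra borel)"
    using assms by (rule measurable_prob_algebraD)
  have [measurable]: "(\<lambda>z :: real ^ 'd. tensor z z) \<in> borel_measurable borel"
    by (intro borel_measurable_continuous_onI continuous_intros)
  show "(\<lambda>x. barycenter (\<kappa> x)) \<in> borel_measurable X"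
    unfolding barycenter_def by measurable
  show "(\<lambda>x. second_moment (\<kappa> x)) \<in> borel_measurable X"
    unfolding second_moment_def by measurable
  show "(\<lambda>x. LINT z|\<kappa> x. (norm z)\<^sup>2) \<in> borel_measurable X"
    by measurable
  show "(\<lambda>x. \<integral>\<^sup>+ z. ennreal ((norm z)\<^sup>2) \<partial>\<kappa> x) \<in> borel_measurable X"
    by measurable
qed

text \<open>
  The energy inequality is stated with extended nonnegative integrals; it is the only source of integrability
  for the moments of the Young measure and is converted here to an inequality between real numbers.
\<close>

lemma integrable_moments:
  fixes \<kappa> :: "'a \<Rightarrow> (real ^ 'd) measure"
  assumes X: "finite_measure X" and \<kappa>: "\<kappa> \<in> measurable X (prob_algebra borel)"
    and le: "(\<integral>\<^sup>+ x. \<integral>\<^sup>+ z. ennreal ((norm z)\<^sup>2) \<partial>\<kappa> x \<partial>X) / 2 + ennreal d \<le> ennreal e / 2"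
    and d: "d \<ge> 0" and e: "e \<ge> 0"
  shows "AE x in X. (\<integral>\<^sup>+ z. ennreal ((norm z)\<^sup>2) \<partial>\<kappa> x) < \<infinity>"
    and "integrable X (\<lambda>x. LINT z|\<kappa> x. (norm z)\<^sup>2)"
    and "(LINT x|X. LINT z|\<kappa> x. (norm z)\<^sup>2) / 2 + d \<le> e / 2"
    and "integrable X (\<lambda>x. barycenter (\<kappa> x))"
    and "integrable X (\<lambda>x. second_moment (\<kappa> x))"
proof -
  interpret finite_measure X by (rule X)
  let ?q = "\<lambda>x. \<integral>\<^sup>+ z. ennreal ((norm z)\<^sup>2) \<partial>\<kappa> x"
  let ?s = "\<lambda>x. LINT z|\<kappa> x. (norm z)\<^sup>2"
  note meas = moments_measurable[OF \<kappa>]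
  have prob: "prob_space (\<kappa> x)" and sets: "sets (\<kappa> x) = sets borel" if "x \<in> space X" for x
    using measurable_space[OF \<kappa> that] by (auto simp: space_prob_algebra)
  have "(\<integral>\<^sup>+ x. ?q x \<partial>X) / 2 \<le> ennreal e / 2"
    using le by (rule order_trans[rotated]) simp
  then have "(\<integral>\<^sup>+ x. ?q x \<partial>X) / 2 * 2 \<le> ennreal e / 2 * 2"
    by (rule mult_right_mono) simp
  then have "(\<integral>\<^sup>+ x. ?q x \<partial>X) \<le> ennreal e"
    by (simp add: ennreal_divide_times ennreal_divide_self)
  then have "(\<integral>\<^sup>+ x. ?q x \<partial>X) < \<infinity>"
    by (rule le_less_trans) simp
  then have "AE x in X. ?q x \<noteq> \<infinity>"
    by (intro nn_integral_PInf_AE meas(4)) auto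
  then show fin: "AE x in X. ?q x < \<infinity>"
    by (simp add: less_top)
  have q_eq: "AE x in X. ?q x = ennreal (?s x)"
    using fin AE_space
  proof eventually_elim
    case (elim x)
    show ?case
      by (rule nn_integral_eq_integral[OF integrable_norm_square[OF prob sets]]) (use elim in auto)
  qed
  have I: "(\<integral>\<^sup>+ x. ?q x \<partial>X) = (\<integral>\<^sup>+ x. ennreal (?s x) \<partial>X)"
    by (rule nn_integral_cong_AE[OF q_eq])
  show int: "integrable X ?s"
  proof (rule integrableI_bounded[OF meas(3)])
    show "(\<integral>\<^sup>+ x. ennreal (norm (?s x)) \<partial>X) < \<infinity>"
      using \<open>(\<integral>\<^sup>+ x. ?q x \<partial>X) < \<infinity>\<close> I by simp
  qed
  have "(\<integral>\<^sup>+ x. ?q x \<partial>X) = ennreal (LINT x|X. ?s x)"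
    unfolding I by (rule nn_integral_eq_integral[OF int]) simp
  with le d e show "(LINT x|X. ?s x) / 2 + d \<le> e / 2"
    by (simp add: divide_ennreal[of _ 2, simplified] flip: ennreal_plus)
  show "integrable X (\<lambda>x. barycenter (\<kappa> x))"
  proof (rule Bochner_Integration.integrable_bound)
    show "integrable X (\<lambda>x. 1 + ?s x)" using int by simp
    show "AE x in X. norm (barycenter (\<kappa> x)) \<le> norm (1 + ?s x)"
      using fin AE_space
    proof eventually_elim
      case (elim x)
      then show ?case using norm_barycenter_le[OF prob sets, of x] by simp
    qed
  qed (rule meas)
  show "integrable X (\<lambda>x. second_moment (\<kappa> x))"
  proof (rule Bochner_Integration.integrable_bound[OF int])
    show "AE x in X. norm (second_moment (\<kappa> x)) \<le> norm (?s x)"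
      using fin AE_space
    proof eventually_elim
      case (elim x)
      then show ?case using norm_second_moment_le[OF prob sets, of x] by simp
    qed
  qed (rule meas)
qed

section \<open>Total variation and matrix-valued integrals\<close>

text \<open>
  The partition of the space into \<open>B\<close> and its complement competes in the supremum, except that a partition must
  not contain the empty set.
\<close>

lemma norm_le_total_variation:
  assumes B: "B \<in> sets M" and empty: "\<mu> {} = 0"
  shows "ennreal (norm (\<mu> B)) \<le> total_variation M \<mu>"
proof (cases "B = {}")
  case True
  then show ?thesis using empty by simp
next
  case False
  define P where "P = {B, space M - B} - {{}}"
  have "finite P \<and> P \<subseteq> sets M \<and> partition_on (space M) P"
    using B sets.sets_into_space[OF B] by (auto simp: P_def partition_on_def disjoint_def)
  then have "(\<Sum>A\<in>P. ennreal (norm (\<mu> A))) \<le> total_variation M \<mu>"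
    unfolding total_variation_def by (intro SUP_upper) auto
  moreover have "ennreal (norm (\<mu> B)) \<le> (\<Sum>A\<in>P. ennreal (norm (\<mu> A)))"
    using False by (intro member_le_sum[of B P "\<lambda>A. ennreal (norm (\<mu> A))"]) (auto simp: P_def)
  ultimately show ?thesis by (rule order_trans[rotated])
qed

text \<open>
  The bound holds whether or not the supremum defining the positive variation is countably additive, since
  \<open>measure_of\<close> yields the zero measure if it is not. This replaces a Jordan decomposition.
\<close>

lemma emeasure_positive_variation_le:
  fixes \<mu> :: "'a set \<Rightarrow> real"
  assumes le: "\<And>B. B \<in> sets M \<Longrightarrow> \<bar>\<mu> B\<bar> \<le> norm (\<mu>' B :: 'b::real_normed_vector)"
    and empty: "\<mu>' {} = 0"
  shows "emeasure (positive_variation M \<mu>) (space M) \<le> total_variation M \<mu>'"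
proof -
  have "(SUP B\<in>{B \<in> sets M. B \<subseteq> space M}. ennreal (\<mu> B)) \<le> total_variation M \<mu>'"
  proof (rule SUP_least)
    fix B assume "B \<in> {B \<in> sets M. B \<subseteq> space M}"
    then have B: "B \<in> sets M" by auto
    have "ennreal (\<mu> B) \<le> ennreal (norm (\<mu>' B))"
      using le[OF B] by (intro ennreal_leI) auto
    also have "\<dots> \<le> total_variation M \<mu>'"
      by (rule norm_le_total_variation[where \<mu> = \<mu>', OF B empty])
    finally show "ennreal (\<mu> B) \<le> total_variation M \<mu>'" .
  qed
  then show ?thesis
    unfolding positive_variation_def by (simp add: emeasure_measure_of_conv)
qed

text \<open>
  Valid for every \<open>f\<close>, because the Bochner integral of a function that is not integrable is \<open>0\<close>.
\<close>

lemma abs_integral_le_bound: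
  fixes f :: "'a \<Rightarrow> real"
  assumes "emeasure N (space N) \<le> ennreal V" and "V \<ge> 0" "B \<ge> 0"
    and "\<And>x. x \<in> space N \<Longrightarrow> \<bar>f x\<bar> \<le> B"
  shows "\<bar>integral\<^sup>L N f\<bar> \<le> B * V"
proof -
  interpret finite_measure N
    using assms(1) by (intro finite_measureI) (auto simp: top_unique)
  have "measure N (space N) \<le> V"
    using assms(1,2) by (simp add: emeasure_eq_measure)
  have "\<bar>integral\<^sup>L N f\<bar> \<le> (LINT x|N. B)"
  proof (cases "integrable N f")
    case True
    then show ?thesis
      using assms(4) by (intro order_trans[OF integral_abs_bound] integral_mono) auto
  next
    case False
    then show ?thesis using assms(3) by (simp add: not_integrable_integral_eq)
  qed
  also have "\<dots> \<le> B * V"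
    using \<open>measure N (space N) \<le> V\<close> assms(3) by (simp add: mult.commute mult_left_mono)
  finally show ?thesis .
qed

text \<open>
  Each of the \<open>d\<^sup>2\<close> entries contributes a positive and a negative variation, hence the factor \<open>2 d\<^sup>2\<close>.
\<close>

lemma abs_matrix_integral_le:
  fixes \<mu> :: "'a set \<Rightarrow> real ^ 'd ^ 'd"
  assumes tv: "total_variation M \<mu> \<le> ennreal V" and V: "V \<ge> 0" and B: "B \<ge> 0"
    and empty: "\<mu> {} = 0"
    and G: "\<And>x. x \<in> space M \<Longrightarrow> norm (G x) \<le> B"
  shows "\<bar>matrix_integral M \<mu> G\<bar> \<le> 2 * (real CARD('d))\<^sup>2 * B * V"
proof -
  have comp: "\<bar>A $ i $ j\<bar> \<le> norm A" for A :: "real ^ 'd ^ 'd" and i j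
    by (rule order_trans[OF component_le_norm_cart Finite_Cartesian_Product.norm_nth_le])
  have *: "\<bar>integral\<^sup>L (positive_variation M \<rho>) (\<lambda>x. G x $ i $ j)\<bar> \<le> B * V"
    if "\<And>A. \<bar>\<rho> A\<bar> \<le> norm (\<mu> A)" for \<rho> i j
  proof (rule abs_integral_le_bound[OF _ V B])
    have sp: "space (positive_variation M \<rho>) = space M"
      by (simp add: positive_variation_def)
    show "emeasure (positive_variation M \<rho>) (space (positive_variation M \<rho>)) \<le> ennreal V"
      unfolding sp using emeasure_positive_variation_le[of M \<rho> \<mu>] that empty tv
      by (blast intro: order_trans)
    show "\<bar>G x $ i $ j\<bar> \<le> B" if "x \<in> space (positive_variation M \<rho>)" for x
      using comp[of "G x" i j] G[of x] that unfolding sp by linarith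
  qed
  have "\<bar>matrix_integral M \<mu> G\<bar> \<le> (\<Sum>i\<in>(UNIV :: 'd set). \<Sum>j\<in>(UNIV :: 'd set). 2 * (B * V))"
    unfolding matrix_integral_def
  proof (rule order_trans[OF sum_abs], rule sum_mono, rule order_trans[OF sum_abs], rule sum_mono)
    fix i j
    show "\<bar>signed_integral M (\<lambda>A. \<mu> A $ i $ j) (\<lambda>x. G x $ i $ j)\<bar> \<le> 2 * (B * V)"
      using *[of "\<lambda>A. \<mu> A $ i $ j" i j] *[of "\<lambda>A. - \<mu> A $ i $ j" i j] comp
      by (simp add: signed_integral_def)
  qed
  also have "\<dots> = 2 * (real CARD('d))\<^sup>2 * B * V"
    by (simp add: power2_eq_square)
  finally show ?thesis .
qed

section \<open>Calculus of continuously differentiable fields on the torus\<close>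

lemma matrix_vector_mult_axis_nth: "(A *v axis j 1) $ i = (A :: real ^ 'd ^ 'd) $ i $ j"
  by (simp add: matrix_vector_mul_component inner_axis)

text \<open>
  Restricting the joint derivative within \<open>UNIV \<times> {0..T}\<close> to a slice of fixed \<open>t\<close> or of fixed \<open>x\<close> identifies
  \<open>grad_x U\<close> and \<open>dt T U\<close> with its components; in particular both are continuous up to the times \<open>0\<close> and \<open>T\<close>.
\<close>

lemma C1_torus_time_differentiable:
  fixes U :: "(real ^ 'd) \<times> real \<Rightarrow> real ^ 'd"
  assumes C1: "C1_torus_time T U" and T: "T > 0"
  shows continuous_on_C1_torus_time: "continuous_on (UNIV \<times> {0..T}) U"
    and continuous_on_grad_x: "continuous_on (UNIV \<times> {0..T}) (grad_x U)"
    and continuous_on_dt: "continuous_on (UNIV \<times> {0..T}) (dt T U)"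
    and has_derivative_grad_x: "t \<in> {0..T} \<Longrightarrow> ((\<lambda>y. U (y, t)) has_derivative (\<lambda>h. grad_x U (x, t) *v h)) (at x)"
    and has_vector_derivative_dt: "t \<in> {0..T} \<Longrightarrow> ((\<lambda>s. U (x, s)) has_vector_derivative dt T U (x, t)) (at t within {0..T})"
proof -
  from C1 obtain f' where der: "\<And>x t. t \<in> {0..T} \<Longrightarrow>
      (U has_derivative blinfun_apply (f' (x, t))) (at (x, t) within UNIV \<times> {0..T})"
    and cont: "continuous_on (UNIV \<times> {0..T}) f'"
    unfolding C1_torus_time_def C1_on_def by blast
  have space: "((\<lambda>y. U (y, t)) has_derivative (\<lambda>h. f' (x, t) (h, 0))) (at x)" if "t \<in> {0..T}" for x t
  proof -
    have "((\<lambda>y. (y, t)) has_derivative (\<lambda>h. (h, 0))) (at x)"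
      by (intro derivative_eq_intros) auto
    moreover have "(U has_derivative blinfun_apply (f' (x, t))) (at (x, t) within (\<lambda>y. (y, t)) ` UNIV)"
      using der[OF that] by (rule has_derivative_subset) (use that in auto)
    ultimately show ?thesis
      by (rule has_derivative_in_compose[where f = "\<lambda>y. (y, t)" and s = UNIV, simplified])
  qed
  have time: "((\<lambda>s. U (x, s)) has_vector_derivative f' (x, t) (0, 1)) (at t within {0..T})"
    if "t \<in> {0..T}" for x t
  proof -
    have "((\<lambda>s. (x, s)) has_derivative (\<lambda>h. (0, h))) (at t within {0..T})"
      by (intro derivative_eq_intros) auto
    moreover have "(U has_derivative blinfun_apply (f' (x, t))) (at (x, t) within (\<lambda>s. (x, s)) ` {0..T})"
      using der[OF that] by (rule has_derivative_subset) auto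
    ultimately have "((\<lambda>s. U (x, s)) has_derivative (\<lambda>h. f' (x, t) (0, h))) (at t within {0..T})"
      by (rule has_derivative_in_compose[where f = "\<lambda>s. (x, s)"])
    moreover have "(\<lambda>h. f' (x, t) (0, h)) = (\<lambda>h. h *\<^sub>R f' (x, t) (0, 1))"
      by (simp flip: blinfun.scaleR_right)
    ultimately show ?thesis by (simp add: has_vector_derivative_def)
  qed
  have dt_eq: "dt T U (x, t) = f' (x, t) (0, 1)" if "t \<in> {0..T}" for x t
    unfolding dt_def using vector_derivative_within_closed_interval[OF T that time[OF that]] by simp
  have grad_eq: "grad_x U (x, t) = matrix (\<lambda>h. f' (x, t) (h, 0))" if "t \<in> {0..T}" for x t
    unfolding grad_x_def jacobian_def using frechet_derivative_at[OF space[OF that]] by simp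
  have lin: "linear (\<lambda>h. f' (x, t) (h, 0))" if "t \<in> {0..T}" for x t
    using has_derivative_linear[OF space[OF that]] .
  show "continuous_on (UNIV \<times> {0..T}) U"
    unfolding continuous_on_eq_continuous_within
    by (auto intro: has_derivative_continuous[OF der])
  have "continuous_on (UNIV \<times> {0..T}) (\<lambda>p. \<chi> i j. f' p (axis j 1, 0) $ i)"
    by (intro continuous_intros cont)
  then show "continuous_on (UNIV \<times> {0..T}) (grad_x U)"
    by (rule continuous_on_eq) (auto simp: grad_eq matrix_def)
  have "continuous_on (UNIV \<times> {0..T}) (\<lambda>p. f' p (0, 1))"
    by (intro continuous_intros cont)
  then show "continuous_on (UNIV \<times> {0..T}) (dt T U)"
    by (rule continuous_on_eq) (auto simp: dt_eq)
  show "((\<lambda>y. U (y, t)) has_derivative (\<lambda>h. grad_x U (x, t) *v h)) (at x)" if "t \<in> {0..T}"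
    using space[OF that] by (simp only: grad_eq[OF that] matrix_vector_mul(2)[OF lin[OF that]])
  show "((\<lambda>s. U (x, s)) has_vector_derivative dt T U (x, t)) (at t within {0..T})" if "t \<in> {0..T}"
    using time[OF that] by (simp add: dt_eq[OF that])
qed

lemma divergence_eq_trace:
  assumes "(F has_derivative (\<lambda>h. A *v h)) (at x)"
  shows "divergence F x = trace A"
  unfolding divergence_def jacobian_def
  using frechet_derivative_at[OF assms] by (metis matrix_of_matrix_vector_mul)

lemma mat_divergence_tensor:
  fixes F :: "real ^ 'd \<Rightarrow> real ^ 'd"
  assumes F: "(F has_derivative (\<lambda>h. A *v h)) (at x)"
  shows "mat_divergence (\<lambda>y. tensor (F y) (F y)) x = A *v F x + divergence F x *\<^sub>R F x"
proof -
  have "divergence (\<lambda>y. tensor (F y) (F y) $ i) x = (A *v F x) $ i + trace A * F x $ i" for i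
  proof -
    have row: "(\<lambda>y. tensor (F y) (F y) $ i) = (\<lambda>y. (F y $ i) *\<^sub>R F y)"
      by (simp add: tensor_def vec_eq_iff fun_eq_iff)
    have Fi: "((\<lambda>y. F y $ i) has_derivative (\<lambda>h. (A *v h) $ i)) (at x)"
      using bounded_linear.has_derivative[OF bounded_linear_vec_nth F] .
    have "((\<lambda>y. tensor (F y) (F y) $ i) has_derivative
        (\<lambda>h. (F x $ i) *\<^sub>R (A *v h) + (A *v h) $ i *\<^sub>R F x)) (at x)"
      unfolding row by (rule has_derivative_scaleR[OF Fi F])
    then have "divergence (\<lambda>y. tensor (F y) (F y) $ i) x
        = trace (matrix (\<lambda>h. (F x $ i) *\<^sub>R (A *v h) + (A *v h) $ i *\<^sub>R F x))"
      unfolding divergence_def jacobian_def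
      by (rule arg_cong[OF frechet_derivative_at[symmetric], where f = "\<lambda>D. trace (matrix D)"])
    also have "\<dots> = (\<Sum>j\<in>UNIV. F x $ i * A $ j $ j + A $ i $ j * F x $ j)"
      unfolding trace_def matrix_def by (simp add: matrix_vector_mult_axis_nth)
    also have "\<dots> = (A *v F x) $ i + trace A * F x $ i"
      by (simp add: sum.distrib trace_def matrix_vector_mult_def sum_distrib_left mult.commute)
    finally show ?thesis .
  qed
  then show ?thesis
    by (simp add: mat_divergence_def vec_eq_iff divergence_eq_trace[OF F])
qed

lemma has_derivative_inner_gradient:
  assumes "\<psi> differentiable (at x)"
  shows "(\<psi> has_derivative (\<lambda>h. gradient \<psi> x \<bullet> h)) (at x)"
proof -
  let ?D = "frechet_derivative \<psi> (at x)"
  have D: "(\<psi> has_derivative ?D) (at x)"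
    using assms by (simp add: frechet_derivative_works)
  then have lin: "linear ?D" by (rule has_derivative_linear)
  have "?D h = gradient \<psi> x \<bullet> h" for h
  proof -
    have "?D h = ?D (\<Sum>i\<in>UNIV. h $ i *\<^sub>R axis i 1)"
      using basis_expansion[of h] by (simp add: scalar_mult_eq_scaleR)
    also have "\<dots> = (\<Sum>i\<in>UNIV. h $ i * ?D (axis i 1))"
      using lin by (simp add: linear_sum linear_cmul)
    also have "\<dots> = gradient \<psi> x \<bullet> h"
      by (simp add: gradient_def inner_vec_def mult.commute)
    finally show ?thesis .
  qed
  then have "?D = (\<lambda>h. gradient \<psi> x \<bullet> h)" by auto
  with D show ?thesis by simp
qed

lemma gradient_eq:
  assumes "(\<psi> has_derivative (\<lambda>h. g \<bullet> h)) (at x)"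
  shows "gradient \<psi> x = g"
proof -
  have "frechet_derivative \<psi> (at x) = (\<lambda>h. g \<bullet> h)"
    using frechet_derivative_at[OF assms] by simp
  then show ?thesis by (simp add: gradient_def vec_eq_iff inner_axis)
qed

lemma C1_torusI:
  assumes "periodic \<psi>" and der: "\<And>x. (\<psi> has_derivative (\<lambda>h. g x \<bullet> h)) (at x)" and cont: "continuous_on UNIV g"
  shows "C1_torus \<psi>"
proof -
  have "continuous_on UNIV (\<lambda>x. blinfun_inner_right (g x))"
    by (intro bounded_linear.continuous_on[OF bounded_linear_blinfun_inner_right] cont)
  then show ?thesis
    unfolding C1_torus_def C1_on_def using assms
    by (intro conjI exI[of _ "\<lambda>x. blinfun_inner_right (g x)"]) auto
qed

lemma torus_borel [measurable]: "(torus :: (real ^ 'd) set) \<in> sets borel"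
proof -
  have "(torus :: (real ^ 'd) set) = (\<Inter>i. {x. 0 \<le> x $ i} \<inter> {x. x $ i < 1})"
    by (auto simp: torus_def)
  also have "\<dots> \<in> sets borel"
    by (intro sets.countable_INT'' sets.Int borel_closed borel_open closed_Collect_le open_Collect_less continuous_intros) auto
  finally show ?thesis .
qed

lemma torus_subset_cbox: "(torus :: (real ^ 'd) set) \<subseteq> cbox 0 1"
  by (auto simp: torus_def mem_box_cart less_imp_le)

lemma emeasure_torus_finite: "emeasure lborel (torus :: (real ^ 'd) set) < \<infinity>"
proof -
  have "emeasure lborel (torus :: (real ^ 'd) set) \<le> emeasure lborel (cbox 0 1 :: (real ^ 'd) set)"
    by (intro emeasure_mono torus_subset_cbox) auto
  also have "\<dots> < \<infinity>" by (rule emeasure_lborel_cbox_finite)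
  finally show ?thesis .
qed

lemma bounded_on_torus:
  fixes f :: "real ^ 'd \<Rightarrow> 'b::real_normed_vector"
  assumes "continuous_on UNIV f"
  obtains K where "K \<ge> 0" "\<And>x. x \<in> torus \<Longrightarrow> norm (f x) \<le> K"
proof -
  have "bounded (f ` cbox 0 1)"
    using assms by (intro compact_imp_bounded compact_continuous_image) (auto intro: continuous_on_subset)
  then obtain K where "K > 0" "\<And>x. x \<in> cbox 0 1 \<Longrightarrow> norm (f x) \<le> K"
    by (auto simp: bounded_pos)
  then show ?thesis using torus_subset_cbox by (intro that[of K]) (auto intro: less_imp_le)
qed

lemma bounded_on_torus_time:
  fixes f :: "(real ^ 'd) \<times> real \<Rightarrow> 'b::real_normed_vector"
  assumes "continuous_on (UNIV \<times> {0..T}) f"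
  obtains K where "K > 0" "\<And>x t. x \<in> torus \<Longrightarrow> t \<in> {0..T} \<Longrightarrow> norm (f (x, t)) \<le> K"
proof -
  have "bounded (f ` (cbox 0 1 \<times> {0..T}))"
    using assms by (intro compact_imp_bounded compact_continuous_image compact_Times) (auto intro: continuous_on_subset)
  then obtain K where "K > 0" "\<And>p. p \<in> cbox 0 1 \<times> {0..T} \<Longrightarrow> norm (f p) \<le> K"
    by (auto simp: bounded_pos)
  then show ?thesis using torus_subset_cbox by (intro that[of K]) (auto simp: subset_iff)
qed

lemma lborel_integral_shift:
  fixes g :: "'a::euclidean_space \<Rightarrow> real"
  assumes [measurable]: "g \<in> borel_measurable borel"
  shows "(LINT x|lborel. g (x + c)) = (LINT x|lborel. g x)"
proof -
  have "(LINT x|lborel. g x) = (LINT x|distr lborel borel ((+) c). g x)"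
    by (simp add: lborel_distr_plus)
  also have "\<dots> = (LINT x|lborel. g (c + x))"
    by (rule integral_distr) measurable
  finally show ?thesis by (simp add: add.commute)
qed

text \<open>
  The cube shifted by \<open>h\<close> exceeds the unit cube in the slab \<open>1 \<le> x\<^sub>i < 1 + h\<close>, which periodicity carries
  back onto the missing slab \<open>0 \<le> x\<^sub>i < h\<close>.
\<close>

lemma integral_torus_shift:
  fixes f :: "real ^ 'd \<Rightarrow> real"
  assumes cont: "continuous_on UNIV f" and per: "\<And>x. f (x + axis i 1) = f x"
    and h: "0 \<le> h" "h \<le> 1"
  shows "(LINT x|lebesgue_on torus. f (x + h *\<^sub>R axis i 1)) = (LINT x|lebesgue_on torus. f x)"
proof -
  define e :: "real ^ 'd" where "e = axis i 1"
  have ei: "e $ j = (if j = i then 1 else 0)" for j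
    by (simp add: e_def axis_def)
  define A where "A = {x \<in> (torus :: (real ^ 'd) set). h \<le> x $ i}"
  define B where "B = {x \<in> (torus :: (real ^ 'd) set). x $ i < h}"
  have [measurable]: "f \<in> borel_measurable borel"
    using cont by (rule borel_measurable_continuous_onI)
  have [measurable]: "A \<in> sets borel" "B \<in> sets borel"
  proof -
    have "A = torus \<inter> {x. h \<le> x $ i}" "B = torus \<inter> {x. x $ i < h}" by (auto simp: A_def B_def)
    moreover have "{x :: real ^ 'd. h \<le> x $ i} \<in> sets borel" "{x :: real ^ 'd. x $ i < h} \<in> sets borel"
      by (intro borel_closed borel_open closed_Collect_le open_Collect_less continuous_intros)+
    ultimately show "A \<in> sets borel" "B \<in> sets borel" by auto
  qed
  obtain K where K: "K \<ge> 0" "\<And>x. x \<in> torus \<Longrightarrow> norm (f x) \<le> K"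
    using bounded_on_torus[OF cont] by blast
  have int: "integrable lborel (\<lambda>x. indicator S x * f x)" if [measurable]: "S \<in> sets borel" and "S \<subseteq> torus" for S
  proof (rule integrableI_bounded_set[where A = S and B = K])
    have "emeasure lborel S \<le> emeasure lborel (torus :: (real ^ 'd) set)"
      using that by (intro emeasure_mono) auto
    then show "emeasure lborel S < \<infinity>"
      using emeasure_torus_finite by (rule le_less_trans)
  qed (use that K in auto)
  \<comment> \<open>The shifted cube is the disjoint union of \<open>A\<close> and of \<open>B\<close> translated by \<open>e\<close>.\<close>
  have split: "indicator torus (y - h *\<^sub>R e) = indicator A y + (indicator B (y - e) :: real)" for y
  proof -
    have 1: "y - h *\<^sub>R e \<in> torus \<longleftrightarrow> (\<forall>j. j \<noteq> i \<longrightarrow> 0 \<le> y $ j \<and> y $ j < 1) \<and> h \<le> y $ i \<and> y $ i < 1 + h"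
      by (auto simp: torus_def ei)
    have 2: "y \<in> A \<longleftrightarrow> (\<forall>j. j \<noteq> i \<longrightarrow> 0 \<le> y $ j \<and> y $ j < 1) \<and> h \<le> y $ i \<and> y $ i < 1"
      using h by (auto simp: A_def torus_def) (metis order_trans)
    have 3: "y - e \<in> B \<longleftrightarrow> (\<forall>j. j \<noteq> i \<longrightarrow> 0 \<le> y $ j \<and> y $ j < 1) \<and> 1 \<le> y $ i \<and> y $ i < 1 + h"
      using h by (auto simp: B_def torus_def ei)
    show ?thesis
      using h by (auto simp: indicator_def of_bool_def 1 2 3)
  qed
  have "(LINT x|lebesgue_on torus. f (x + h *\<^sub>R e)) = (LINT x|lborel. indicator torus x * f (x + h *\<^sub>R e))"
    by (subst integral_lebesgue_on_borel) (auto intro!: measurable_restrict_space1)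
  also have "\<dots> = (LINT y|lborel. indicator torus (y - h *\<^sub>R e) * f y)"
    using lborel_integral_shift[of "\<lambda>y. indicator torus (y - h *\<^sub>R e) * f y" "h *\<^sub>R e"] by simp
  also have "\<dots> = (LINT y|lborel. indicator A y * f y + indicator B (y - e) * f y)"
    by (simp only: split distrib_right)
  also have "\<dots> = (LINT y|lborel. indicator A y * f y) + (LINT y|lborel. indicator B (y - e) * f y)"
  proof (rule Bochner_Integration.integral_add)
    show "integrable lborel (\<lambda>y. indicator A y * f y)"
      by (rule int) (auto simp: A_def)
    have "integrable (distr lborel borel ((+) (- e))) (\<lambda>y. indicator B y * f y)"
      unfolding lborel_distr_plus by (rule int) (auto simp: B_def)
    then have "integrable lborel (\<lambda>y. indicator B (- e + y) * f (- e + y))"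
      by (subst (asm) integrable_distr_eq) auto
    moreover have "f (- e + y) = f y" for y
      using per[of "- e + y"] by (simp add: e_def)
    ultimately show "integrable lborel (\<lambda>y. indicator B (y - e) * f y)"
      by (simp add: add.commute)
  qed
  also have "(LINT y|lborel. indicator B (y - e) * f y) = (LINT y|lborel. indicator B y * f y)"
    using lborel_integral_shift[of "\<lambda>y. indicator B (y - e) * f y" e] per by (simp add: e_def)
  also have "(LINT y|lborel. indicator A y * f y) + (LINT y|lborel. indicator B y * f y)
      = (LINT y|lborel. indicator A y * f y + indicator B y * f y)"
    by (rule Bochner_Integration.integral_add[symmetric]; rule int) (auto simp: A_def B_def)
  also have "\<dots> = (LINT y|lborel. indicator torus y *\<^sub>R f y)"
    by (intro Bochner_Integration.integral_cong) (auto simp: A_def B_def split: split_indicator)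
  also have "\<dots> = (LINT x|lebesgue_on torus. f x)"
    by (subst integral_lebesgue_on_borel) (auto intro!: measurable_restrict_space1)
  finally show ?thesis by (simp add: e_def)
qed

text \<open>
  By translation invariance the integral of the derivative does not change if it is averaged over all shifts
  \<open>s \<in> (0,1)\<close> in direction \<open>i\<close>; after exchanging the integrals, the fundamental theorem of calculus turns
  the average into the difference of \<open>f\<close> at two points that are identified on the torus. This avoids slicing
  the cube into coordinates.
\<close>

lemma integral_torus_partial_derivative:
  fixes f :: "real ^ 'd \<Rightarrow> real"
  assumes per: "periodic f"
    and der: "\<And>x. (f has_derivative (\<lambda>h. g x \<bullet> h)) (at x)" and cont: "continuous_on UNIV g"
  shows "(LINT x|lebesgue_on torus. g x $ i) = 0"
proof -
  define e :: "real ^ 'd" where "e = axis i 1"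
  define D where "D = (\<lambda>x. g x $ i)"
  have contD: "continuous_on UNIV D"
    unfolding D_def by (intro continuous_intros cont)
  have fe: "f (x + e) = f x" for x using per by (simp add: periodic_def e_def)
  have De: "D (x + e) = D x" for x
  proof -
    have "((\<lambda>y. f (y + e)) has_derivative (\<lambda>h. g (x + e) \<bullet> h)) (at x)"
      using der[of "x + e"]
      by (rule has_derivative_compose[where f = "\<lambda>y. y + e", rotated]) (auto intro!: derivative_eq_intros)
    then have "(f has_derivative (\<lambda>h. g (x + e) \<bullet> h)) (at x)" by (simp add: fe)
    from has_derivative_unique[OF this der[of x]] have "g (x + e) \<bullet> e = g x \<bullet> e" by metis
    then show ?thesis by (simp add: D_def e_def inner_axis)
  qed
  have line: "((\<lambda>s. f (x + s *\<^sub>R e)) has_vector_derivative D (x + s *\<^sub>R e)) (at s within {0..1})" for x s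
  proof -
    have "((\<lambda>s. f (x + s *\<^sub>R e)) has_derivative (\<lambda>h. g (x + s *\<^sub>R e) \<bullet> (h *\<^sub>R e))) (at s within {0..1})"
      using der[of "x + s *\<^sub>R e"]
      by (rule has_derivative_compose[where f = "\<lambda>s. x + s *\<^sub>R e", rotated]) (auto intro!: derivative_eq_intros)
    then show ?thesis
      by (simp add: has_vector_derivative_def D_def e_def inner_axis)
  qed
  have contp: "continuous_on UNIV (\<lambda>p :: (real ^ 'd) \<times> real. D (fst p + snd p *\<^sub>R e))"
    by (intro continuous_on_compose2[OF contD] continuous_intros) auto
  obtain K where K: "\<And>x t. x \<in> torus \<Longrightarrow> t \<in> {0..1} \<Longrightarrow> norm (D (x + t *\<^sub>R e)) \<le> K"
    using bounded_on_torus_time[OF continuous_on_subset[OF contp subset_UNIV]] by (metis fst_conv snd_conv)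
  have "(LINT x|lebesgue_on torus. D x) = (LINT s|lebesgue_on {0<..<1::real}. LINT x|lebesgue_on torus. D x)"
    by (simp add: measure_restrict_space)
  also have "\<dots> = (LINT s|lebesgue_on {0<..<1::real}. LINT x|lebesgue_on torus. D (x + s *\<^sub>R e))"
    unfolding e_def
    by (intro Bochner_Integration.integral_cong refl integral_torus_shift[symmetric] contD De[unfolded e_def])
      (auto simp: space_restrict_space)
  also have "\<dots> = (LINT x|lebesgue_on torus. LINT s|lebesgue_on {0<..<1::real}. D (x + s *\<^sub>R e))"
    using emeasure_torus_finite K borel_measurable_continuous_on_restrict[OF continuous_on_subset[OF contp]]
    by (intro integral_lebesgue_on_swap[of torus "{0<..<1::real}" "\<lambda>p. D (fst p + snd p *\<^sub>R e)" K,
          symmetric, unfolded fst_conv snd_conv]) auto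
  also have "\<dots> = (LINT x|lebesgue_on torus. f (x + 1 *\<^sub>R e) - f (x + 0 *\<^sub>R e))"
    by (intro Bochner_Integration.integral_cong refl integral_FTC_lebesgue_on line
        continuous_on_compose2[OF contD] continuous_intros) auto
  also have "\<dots> = 0" by (simp add: fe)
  finally show ?thesis by (simp add: D_def)
qed

text \<open>
  \<open>F \<bullet> \<nabla>p = div (p F)\<close> when \<open>div F = 0\<close>, and the integral of each \<open>\<partial>\<^sub>i (p F\<^sub>i)\<close> vanishes.
\<close>

lemma integral_torus_divergence_free_gradient:
  fixes F :: "real ^ 'd \<Rightarrow> real ^ 'd" and p :: "real ^ 'd \<Rightarrow> real"
  assumes perF: "periodic F" and perp: "periodic p"
    and F: "\<And>x. (F has_derivative (\<lambda>h. A x *v h)) (at x)" and contA: "continuous_on UNIV A"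
    and p: "\<And>x. (p has_derivative (\<lambda>h. g x \<bullet> h)) (at x)" and contg: "continuous_on UNIV g"
    and div: "\<And>x. divergence F x = 0"
  shows "(LINT x|lebesgue_on torus. F x \<bullet> g x) = 0"
proof -
  define G where "G = (\<lambda>i x. p x *\<^sub>R (A x $ i) + (F x $ i) *\<^sub>R g x)"
  have contF: "continuous_on UNIV F" and contp: "continuous_on UNIV p"
    using F p by (auto intro!: continuous_at_imp_continuous_on has_derivative_continuous)
  have contG: "continuous_on UNIV (G i)" for i
    unfolding G_def by (intro continuous_intros contA contg contF contp)
  have zero: "(LINT x|lebesgue_on torus. G i x $ i) = 0" for i
  proof (rule integral_torus_partial_derivative[OF _ _ contG])
    show "periodic (\<lambda>x. p x * F x $ i)"
      using perF perp by (simp add: periodic_def)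
    fix x
    have "((\<lambda>y. F y $ i) has_derivative (\<lambda>h. (A x *v h) $ i)) (at x)"
      using bounded_linear.has_derivative[OF bounded_linear_vec_nth F] .
    from has_derivative_mult[OF p this]
    show "((\<lambda>x. p x * F x $ i) has_derivative (\<lambda>h. G i x \<bullet> h)) (at x)"
      by (rule has_derivative_eq_rhs)
        (auto simp: G_def inner_add_left matrix_vector_mul_component)
  qed
  have int: "integrable (lebesgue_on torus) (\<lambda>x. G i x $ i)" for i
  proof -
    have c: "continuous_on UNIV (\<lambda>x. G i x $ i)" by (intro continuous_intros contG)
    obtain K where K: "\<And>x. x \<in> torus \<Longrightarrow> norm (G i x $ i) \<le> K"
      using bounded_on_torus[OF c] by auto
    interpret finite_measure "lebesgue_on (torus :: (real ^ 'd) set)"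
      by (rule finite_measure_lebesgue_on_borel) (auto simp: emeasure_torus_finite[simplified])
    show ?thesis
    proof (rule integrable_const_bound[where B = K])
      show "(\<lambda>x. G i x $ i) \<in> borel_measurable (lebesgue_on torus)"
        by (intro borel_imp_lebesgue_on borel_measurable_continuous_on_restrict continuous_on_subset[OF c]) auto
      show "AE x in lebesgue_on torus. norm (G i x $ i) \<le> K"
        by (rule eventually_mono[OF AE_space]) (use K in \<open>auto simp: space_restrict_space\<close>)
    qed
  qed
  have "F x \<bullet> g x = (\<Sum>i\<in>UNIV. G i x $ i)" for x
  proof -
    have "(\<Sum>i\<in>UNIV. G i x $ i) = p x * trace (A x) + F x \<bullet> g x"
      by (simp add: G_def sum.distrib trace_def sum_distrib_left inner_vec_def)
    then show ?thesis using div[of x] divergence_eq_trace[OF F, of x] by simp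
  qed
  then have "(LINT x|lebesgue_on torus. F x \<bullet> g x) = (\<Sum>i\<in>UNIV. LINT x|lebesgue_on torus. G i x $ i)"
    using int by simp
  then show ?thesis by (simp add: zero)
qed

section \<open>Integrability of fields on the torus\<close>

lemma continuous_on_matrix_vector_mult [continuous_intros]:
  fixes A :: "'a::topological_space \<Rightarrow> real ^ 'n ^ 'm"
  assumes "continuous_on S A" "continuous_on S v"
  shows "continuous_on S (\<lambda>x. A x *v v x)"
  unfolding matrix_vector_mult_def by (intro continuous_intros assms)

lemma continuous_on_vector_matrix_mult [continuous_intros]:
  fixes A :: "'a::topological_space \<Rightarrow> real ^ 'n ^ 'm"
  assumes "continuous_on S A" "continuous_on S v"
  shows "continuous_on S (\<lambda>x. v x v* A x)"
  unfolding vector_matrix_mult_def by (intro continuous_intros assms)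

lemma finite_measure_torus: "finite_measure (lebesgue_on (torus :: (real ^ 'd) set))"
  by (rule finite_measure_lebesgue_on_borel[OF torus_borel emeasure_torus_finite])

lemma space_lebesgue_on: "space (lebesgue_on A) = A"
  by (simp add: space_restrict_space)

lemma continuous_on_time_slice:
  assumes "continuous_on (UNIV \<times> {0..T}) f" "t \<in> {0..T}"
  shows "continuous_on UNIV (\<lambda>x. f (x, t))"
  by (rule continuous_on_compose2[OF assms(1)]) (use assms(2) in \<open>auto intro!: continuous_intros\<close>)

lemma continuous_imp_measurable_torus:
  assumes "continuous_on UNIV (f :: real ^ 'd \<Rightarrow> 'b::topological_space)"
  shows "f \<in> borel_measurable (lebesgue_on torus)"
  by (intro borel_imp_lebesgue_on borel_measurable_continuous_on_restrict continuous_on_subset[OF assms]) auto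

lemma continuous_imp_measurable_torus_time:
  assumes "continuous_on (UNIV \<times> {0..T}) (f :: (real ^ 'd) \<times> real \<Rightarrow> 'b::topological_space)"
  shows "f \<in> borel_measurable (restrict_space borel (torus \<times> {0<..<T}))"
  by (intro borel_measurable_continuous_on_restrict continuous_on_subset[OF assms]) auto

lemma integrable_bounded_finite_measure:
  fixes f :: "'a \<Rightarrow> 'b::{banach, second_countable_topology}"
  assumes "finite_measure X" "f \<in> borel_measurable X" "\<And>x. x \<in> space X \<Longrightarrow> norm (f x) \<le> K"
  shows "integrable X f"
proof -
  interpret finite_measure X by fact
  show ?thesis
    by (rule integrable_const_bound[where B = K]) (use assms in auto)
qed

lemma integrable_continuous_torus:
  fixes f :: "real ^ 'd \<Rightarrow> 'b::{banach, second_countable_topology}"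
  assumes "continuous_on UNIV f"
  shows "integrable (lebesgue_on torus) f"
proof -
  obtain K where "\<And>x. x \<in> torus \<Longrightarrow> norm (f x) \<le> K"
    using bounded_on_torus[OF assms] by blast
  then show ?thesis
    by (intro integrable_bounded_finite_measure[OF finite_measure_torus continuous_imp_measurable_torus[OF assms]])
      (auto simp: space_lebesgue_on)
qed

lemma integrable_inner_bounded:
  fixes f h :: "'a \<Rightarrow> 'b::{banach, second_countable_topology, real_inner}"
  assumes f: "integrable X f" and h: "h \<in> borel_measurable X" "\<And>x. x \<in> space X \<Longrightarrow> norm (h x) \<le> K"
  shows "integrable X (\<lambda>x. h x \<bullet> f x)"
proof (rule Bochner_Integration.integrable_bound)
  show "integrable X (\<lambda>x. K * norm (f x))" using f by simp
  show "(\<lambda>x. h x \<bullet> f x) \<in> borel_measurable X" using f h(1) by measurable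
  show "AE x in X. norm (h x \<bullet> f x) \<le> norm (K * norm (f x))"
  proof (rule eventually_mono[OF AE_space])
    fix x assume x: "x \<in> space X"
    have "\<bar>h x \<bullet> f x\<bar> \<le> norm (h x) * norm (f x)" by (rule Cauchy_Schwarz_ineq2)
    also have "\<dots> \<le> K * norm (f x)" using h(2)[OF x] by (intro mult_right_mono) auto
    finally show "norm (h x \<bullet> f x) \<le> norm (K * norm (f x))" by simp
  qed
qed

lemma integrable_inner_continuous_torus:
  fixes f h :: "real ^ 'd \<Rightarrow> 'b::{banach, second_countable_topology, real_inner}"
  assumes f: "integrable (lebesgue_on torus) f" and h: "continuous_on UNIV h"
  shows "integrable (lebesgue_on torus) (\<lambda>x. h x \<bullet> f x)"
proof -
  obtain K where "\<And>x. x \<in> torus \<Longrightarrow> norm (h x) \<le> K"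
    using bounded_on_torus[OF h] by blast
  then show ?thesis
    by (intro integrable_inner_bounded[OF f continuous_imp_measurable_torus[OF h]])
      (auto simp: space_lebesgue_on)
qed

lemma integrable_lebesgue_on_subset:
  fixes f :: "'a::euclidean_space \<Rightarrow> real"
  assumes "integrable (lebesgue_on A) f" "B \<subseteq> A" "A \<in> sets lebesgue" "B \<in> sets lebesgue"
  shows "integrable (lebesgue_on B) f"
proof -
  have "set_integrable lebesgue A f"
    using assms by (simp add: set_integrable_def integrable_restrict_space)
  then have "set_integrable lebesgue B f"
    by (rule set_integrable_subset) (use assms in auto)
  then show ?thesis
    using assms by (simp add: set_integrable_def integrable_restrict_space)
qed

section \<open>Energy balance and pressure of a strong solution\<close>

text \<open>
  The null set of times in the hypothesis depends on \<open>r\<close>, so \<open>r = t\<close> cannot be substituted directly. A common null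
  set serves all rational \<open>r\<close>; for a time \<open>t\<close> outside it, rationals \<open>r\<^sub>n\<close> tend to \<open>t\<close> and dominated
  convergence, with majorant a multiple of \<open>|b(\<cdot>, t)|\<close>, passes to the limit.
\<close>

lemma AE_integral_orthogonal_at_time:
  fixes b G :: "(real ^ 'd) \<times> real \<Rightarrow> real ^ 'd"
  assumes T: "T > 0" and G: "continuous_on (UNIV \<times> {0..T}) G"
    and int: "AE t in lebesgue_on {0<..<T}. integrable (lebesgue_on torus) (\<lambda>x. b (x, t))"
    and orth: "\<And>r. r \<in> {0..T} \<Longrightarrow>
      AE t in lebesgue_on {0<..<T}. (LINT x|lebesgue_on torus. b (x, t) \<bullet> G (x, r)) = 0"
  shows "AE t in lebesgue_on {0<..<T}. (LINT x|lebesgue_on torus. b (x, t) \<bullet> G (x, t)) = 0"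
proof -
  obtain K where K: "K > 0" "\<And>x t. x \<in> torus \<Longrightarrow> t \<in> {0..T} \<Longrightarrow> norm (G (x, t)) \<le> K"
    using bounded_on_torus_time[OF G] by blast
  have "countable (\<rat> \<inter> {0..T})" by (simp add: countable_rat)
  then have "AE t in lebesgue_on {0<..<T}. \<forall>r\<in>\<rat> \<inter> {0..T}.
      (LINT x|lebesgue_on torus. b (x, t) \<bullet> G (x, r)) = 0"
    using orth by (subst AE_ball_countable) auto
  then show ?thesis
    using int AE_space
  proof eventually_elim
    case (elim t)
    then have t: "0 < t" "t < T" by (auto simp: space_lebesgue_on)
    have "\<exists>r\<in>\<rat>. t < r \<and> r < min T (t + 1 / real (Suc n))" for n
      using t by (intro Rats_dense_in_real) auto
    then obtain r where r: "\<And>n. r n \<in> \<rat>" "\<And>n. t < r n" "\<And>n. r n < min T (t + 1 / real (Suc n))"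
      by metis
    have rT: "r n \<in> {0..T}" for n using r(2,3)[of n] t by auto
    have "(\<lambda>n. t + 1 / real (Suc n)) \<longlonglongrightarrow> t + 0"
      by (intro tendsto_add tendsto_const LIMSEQ_Suc[OF lim_1_over_n])
    then have r_lim: "r \<longlonglongrightarrow> t"
      by (intro tendsto_sandwich[of "\<lambda>_. t" r _ "\<lambda>n. t + 1 / real (Suc n)"])
        (use r in \<open>auto simp: less_imp_le\<close>)
    have "(\<lambda>n. LINT x|lebesgue_on torus. b (x, t) \<bullet> G (x, r n)) \<longlonglongrightarrow> (LINT x|lebesgue_on torus. b (x, t) \<bullet> G (x, t))"
    proof (rule integral_dominated_convergence[where w = "\<lambda>x. norm (b (x, t)) * K"])
      have [measurable]: "(\<lambda>x. b (x, t)) \<in> borel_measurable (lebesgue_on torus)" using elim by auto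
      have Gm: "(\<lambda>x. G (x, s)) \<in> borel_measurable (lebesgue_on torus)" if "s \<in> {0..T}" for s
        by (intro continuous_imp_measurable_torus continuous_on_time_slice[OF G that])
      show "(\<lambda>x. b (x, t) \<bullet> G (x, t)) \<in> borel_measurable (lebesgue_on torus)"
        using Gm[of t] t by (intro borel_measurable_inner) auto
      show "(\<lambda>x. b (x, t) \<bullet> G (x, r n)) \<in> borel_measurable (lebesgue_on torus)" for n
        using Gm[OF rT] by (intro borel_measurable_inner) auto
      show "integrable (lebesgue_on torus) (\<lambda>x. norm (b (x, t)) * K)" using elim by simp
      have "(\<lambda>n. G (x, r n)) \<longlonglongrightarrow> G (x, t)" for x
        by (rule continuous_on_tendsto_compose[OF G]) (use rT t r_lim in \<open>auto intro!: tendsto_intros\<close>)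
      then show "AE x in lebesgue_on torus. (\<lambda>n. b (x, t) \<bullet> G (x, r n)) \<longlonglongrightarrow> b (x, t) \<bullet> G (x, t)"
        by (intro always_eventually allI tendsto_intros)
      show "AE x in lebesgue_on torus. norm (b (x, t) \<bullet> G (x, r n)) \<le> norm (b (x, t)) * K" for n
      proof (rule eventually_mono[OF AE_space])
        fix x assume "x \<in> space (lebesgue_on (torus :: (real ^ 'd) set))"
        then have "norm (G (x, r n)) \<le> K" using K(2) rT by (simp add: space_lebesgue_on)
        then have "norm (b (x, t)) * norm (G (x, r n)) \<le> norm (b (x, t)) * K"
          by (intro mult_left_mono) auto
        then show "norm (b (x, t) \<bullet> G (x, r n)) \<le> norm (b (x, t)) * K"
          using Cauchy_Schwarz_ineq2[of "b (x, t)" "G (x, r n)"] by simp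
      qed
    qed
    moreover have "(LINT x|lebesgue_on torus. b (x, t) \<bullet> G (x, r n)) = 0" for n
      using elim(1) r(1) rT by blast
    ultimately show ?case
      by (simp add: LIMSEQ_const_iff)
  qed
qed

text \<open>
  The fundamental theorem of calculus for \<open>t \<mapsto> |U(x,t)|\<^sup>2/2\<close> at each \<open>x\<close>, integrated over the torus; exchanging
  the integrals spares a differentiation under the integral sign.
\<close>

lemma kinetic_energy_difference:
  fixes U :: "(real ^ 'd) \<times> real \<Rightarrow> real ^ 'd"
  assumes T: "T > 0" and C1: "C1_torus_time T U" and \<tau>: "\<tau> \<in> {0<..<T}"
  shows "(LINT t|lebesgue_on {0<..<\<tau>}. LINT x|lebesgue_on torus. U (x, t) \<bullet> dt T U (x, t))
    = (LINT x|lebesgue_on torus. (norm (U (x, \<tau>)))\<^sup>2) / 2 - (LINT x|lebesgue_on torus. (norm (U (x, 0)))\<^sup>2) / 2"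
proof -
  note cU = continuous_on_C1_torus_time[OF C1 T]
  note cdt = continuous_on_dt[OF C1 T]
  have c: "continuous_on (UNIV \<times> {0..T}) (\<lambda>p. U p \<bullet> dt T U p)"
    by (intro continuous_intros cU cdt)
  obtain K where K: "\<And>x t. x \<in> torus \<Longrightarrow> t \<in> {0..T} \<Longrightarrow> norm (U (x, t) \<bullet> dt T U (x, t)) \<le> K"
    using bounded_on_torus_time[OF c] by metis
  have "(LINT t|lebesgue_on {0<..<\<tau>}. LINT x|lebesgue_on torus. U (x, t) \<bullet> dt T U (x, t))
      = (LINT x|lebesgue_on torus. LINT t|lebesgue_on {0<..<\<tau>}. U (x, t) \<bullet> dt T U (x, t))"
  proof (rule integral_lebesgue_on_swap[symmetric])
    show "(\<lambda>p. U p \<bullet> dt T U p) \<in> borel_measurable (restrict_space borel (torus \<times> {0<..<\<tau>}))"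
      by (intro borel_measurable_continuous_on_restrict continuous_on_subset[OF c]) (use \<tau> in auto)
    show "norm (U (x, t) \<bullet> dt T U (x, t)) \<le> K" if "x \<in> torus" "t \<in> {0<..<\<tau>}" for x t
      using K[OF that(1)] that(2) \<tau> by auto
  qed (use \<tau> emeasure_torus_finite in auto)
  also have "\<dots> = (LINT x|lebesgue_on torus. (norm (U (x, \<tau>)))\<^sup>2 / 2 - (norm (U (x, 0)))\<^sup>2 / 2)"
  proof (intro Bochner_Integration.integral_cong refl)
    fix x
    have sub: "{0..\<tau>} \<subseteq> {0..T}" using \<tau> by auto
    show "(LINT t|lebesgue_on {0<..<\<tau>}. U (x, t) \<bullet> dt T U (x, t)) = (norm (U (x, \<tau>)))\<^sup>2 / 2 - (norm (U (x, 0)))\<^sup>2 / 2"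
    proof (rule integral_FTC_lebesgue_on)
      show "0 \<le> \<tau>" using \<tau> by simp
      show "continuous_on {0..\<tau>} (\<lambda>t. U (x, t) \<bullet> dt T U (x, t))"
        by (rule continuous_on_compose2[OF c, of _ "\<lambda>t. (x, t)", simplified])
          (use sub in \<open>auto intro!: continuous_intros\<close>)
      fix t assume "0 \<le> t" "t \<le> \<tau>"
      then have "((\<lambda>s. U (x, s)) has_vector_derivative dt T U (x, t)) (at t within {0..\<tau>})"
        using has_vector_derivative_within_subset[OF has_vector_derivative_dt[OF C1 T, of t x] sub] \<tau> by auto
      then have d: "((\<lambda>s. U (x, s)) has_derivative (\<lambda>h. h *\<^sub>R dt T U (x, t))) (at t within {0..\<tau>})"
        by (simp add: has_vector_derivative_def)
      have "((\<lambda>s. (1 / 2) *\<^sub>R (U (x, s) \<bullet> U (x, s))) has_derivative (\<lambda>h. h * (U (x, t) \<bullet> dt T U (x, t)))) (at t within {0..\<tau>})"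
        by (rule has_derivative_eq_rhs[OF has_derivative_scaleR_right[OF has_derivative_inner[OF d d]]])
          (auto simp: inner_commute)
      then show "((\<lambda>s. (norm (U (x, s)))\<^sup>2 / 2) has_vector_derivative U (x, t) \<bullet> dt T U (x, t)) (at t within {0..\<tau>})"
        by (simp add: has_vector_derivative_def power2_norm_eq_inner)
    qed
  qed
  also have "\<dots> = (LINT x|lebesgue_on torus. (norm (U (x, \<tau>)))\<^sup>2) / 2 - (LINT x|lebesgue_on torus. (norm (U (x, 0)))\<^sup>2) / 2"
  proof -
    have "integrable (lebesgue_on torus) (\<lambda>x. (norm (U (x, s)))\<^sup>2)" if "s \<in> {0..T}" for s
      by (intro integrable_continuous_torus continuous_intros continuous_on_time_slice[OF cU that])
    from this[of \<tau>] this[of 0] \<tau> T show ?thesis by simp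
  qed
  finally show ?thesis .
qed

text \<open>
  The value that the Euler equation forces on \<open>\<nabla>p\<close>. In this form its continuity in space and time is evident,
  although the pressure itself need not be regular in time.
\<close>

definition pressure_gradient :: "real \<Rightarrow> ((real ^ 'd) \<times> real \<Rightarrow> real ^ 'd) \<Rightarrow> (real ^ 'd) \<times> real \<Rightarrow> real ^ 'd" where
  "pressure_gradient T U q = - (dt T U q + grad_x U q *v U q)"

lemma continuous_on_pressure_gradient:
  assumes "C1_torus_time T U" "T > 0"
  shows "continuous_on (UNIV \<times> {0..T}) (pressure_gradient T U)"
  unfolding pressure_gradient_def
  by (intro continuous_intros continuous_on_C1_torus_time[OF assms] continuous_on_dt[OF assms] continuous_on_grad_x[OF assms])

lemma euler_pressure:
  fixes U :: "(real ^ 'd) \<times> real \<Rightarrow> real ^ 'd"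
  assumes T: "T > 0" and euler: "euler_strong_solution T U" and t: "t \<in> {0..T}"
  obtains p where "periodic p" "\<And>x. (p has_derivative (\<lambda>h. pressure_gradient T U (x, t) \<bullet> h)) (at x)"
proof -
  have C1: "C1_torus_time T U" and div: "\<And>x. divergence (\<lambda>y. U (y, t)) x = 0"
    using euler t by (auto simp: euler_strong_solution_def)
  from euler obtain p where p: "periodic (\<lambda>x. p (x, t))" "(\<lambda>x. p (x, t)) differentiable_on UNIV"
    and eq: "\<And>x. dt T U (x, t) + mat_divergence (\<lambda>y. tensor (U (y, t)) (U (y, t))) x + gradient (\<lambda>y. p (y, t)) x = 0"
    unfolding euler_strong_solution_def using t by blast
  have "gradient (\<lambda>y. p (y, t)) x = pressure_gradient T U (x, t)" for x
    using minus_unique[OF eq[of x]] mat_divergence_tensor[OF has_derivative_grad_x[OF C1 T t], of x] div[of x]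
    by (simp add: pressure_gradient_def)
  moreover have "(\<lambda>y. p (y, t)) differentiable (at x)" for x
    using p(2) by (simp add: differentiable_on_def)
  ultimately show ?thesis
    using has_derivative_inner_gradient[of "\<lambda>y. p (y, t)"] by (intro that[OF p(1)]) auto
qed

lemma integral_velocity_pressure_gradient:
  fixes U :: "(real ^ 'd) \<times> real \<Rightarrow> real ^ 'd"
  assumes T: "T > 0" and euler: "euler_strong_solution T U" and t: "t \<in> {0..T}"
  shows "(LINT x|lebesgue_on torus. U (x, t) \<bullet> pressure_gradient T U (x, t)) = 0"
proof -
  have C1: "C1_torus_time T U" and div: "\<And>x. divergence (\<lambda>y. U (y, t)) x = 0"
    using euler t by (auto simp: euler_strong_solution_def)
  obtain p where p: "periodic p" "\<And>x. (p has_derivative (\<lambda>h. pressure_gradient T U (x, t) \<bullet> h)) (at x)"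
    using euler_pressure[OF assms] by blast
  show ?thesis
  proof (rule integral_torus_divergence_free_gradient[OF _ p(1) _ _ p(2) _ div, where A = "\<lambda>x. grad_x U (x, t)"])
    show "periodic (\<lambda>x. U (x, t))" using C1 t by (simp add: C1_torus_time_def)
  qed (intro has_derivative_grad_x[OF C1 T t] continuous_on_time_slice[OF _ t]
      continuous_on_pressure_gradient[OF C1 T] continuous_on_grad_x[OF C1 T])+
qed

text \<open>
  The function is \<open>\<psi> = p - |U|\<^sup>2/2\<close> at time \<open>t\<close>; the row vector \<open>U v* grad_x U\<close> is the gradient of
  \<open>|U|\<^sup>2/2\<close>. Since \<open>\<nabla>p\<close> is continuous, a pressure that is merely differentiable in space makes \<open>\<psi>\<close> an
  admissible test function.
\<close>

lemma bernoulli_test_function: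
  fixes U :: "(real ^ 'd) \<times> real \<Rightarrow> real ^ 'd"
  assumes T: "T > 0" and euler: "euler_strong_solution T U" and t: "t \<in> {0..T}"
  obtains \<psi> where "C1_torus \<psi>" "\<And>x. gradient \<psi> x = pressure_gradient T U (x, t) - U (x, t) v* grad_x U (x, t)"
proof -
  have C1: "C1_torus_time T U" using euler by (auto simp: euler_strong_solution_def)
  obtain p where p: "periodic p" "\<And>x. (p has_derivative (\<lambda>h. pressure_gradient T U (x, t) \<bullet> h)) (at x)"
    using euler_pressure[OF assms] by blast
  define \<psi> where "\<psi> = (\<lambda>x. p x - (U (x, t) \<bullet> U (x, t)) / 2)"
  define g where "g = (\<lambda>x. pressure_gradient T U (x, t) - U (x, t) v* grad_x U (x, t))"
  have der: "(\<psi> has_derivative (\<lambda>h. g x \<bullet> h)) (at x)" for x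
    unfolding \<psi>_def
    by (rule has_derivative_eq_rhs, (rule derivative_intros p has_derivative_grad_x[OF C1 T t])+)
      (auto simp: g_def inner_diff_left dot_lmul_matrix inner_commute[of "grad_x U (x, t) *v _"])
  have "periodic (\<lambda>x. U (x, t))" using C1 t by (simp add: C1_torus_time_def)
  then have "periodic \<psi>" using p(1) by (simp add: periodic_def \<psi>_def)
  moreover have "continuous_on UNIV g"
    unfolding g_def
    by (intro continuous_intros continuous_on_time_slice[OF _ t]
      continuous_on_pressure_gradient[OF C1 T] continuous_on_grad_x[OF C1 T] continuous_on_C1_torus_time[OF C1 T])
  ultimately have "C1_torus \<psi>" using C1_torusI der by blast
  then show ?thesis using that gradient_eq[OF der] by (simp add: g_def)
qed

section \<open>Relative energy at a fixed time\<close>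

text \<open>
  The identity behind the relative energy estimate. Here \<open>b\<close> and \<open>S\<close> stand for the first and second moments
  of the Young measure, \<open>V\<close> for the strong solution, \<open>A\<close> for its gradient, \<open>B\<close> for its time derivative, \<open>g\<close> for
  the pressure gradient, \<open>P = A V\<close> and \<open>N\<close> for the gradient of \<open>|V|\<^sup>2/2\<close>. Substituting
  \<open>B = - P - g\<close> and adding the two vanishing integrals completes the square: with these values the last
  integrand is \<open>\<langle>\<nu>, A : (z - V) \<otimes> (z - V)\<rangle>\<close>.
\<close>

lemma momentum_flux_split:
  fixes b V B P N g :: "'a \<Rightarrow> real ^ 'd" and A S :: "'a \<Rightarrow> real ^ 'd ^ 'd"
  assumes g: "\<And>x. g x = - (B x + P x)"
    and int: "integrable X (\<lambda>x. V x \<bullet> B x)" "integrable X (\<lambda>x. A x \<bullet> S x)" "integrable X (\<lambda>x. P x \<bullet> b x)"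
      "integrable X (\<lambda>x. N x \<bullet> b x)" "integrable X (\<lambda>x. V x \<bullet> P x)" "integrable X (\<lambda>x. g x \<bullet> b x)"
      "integrable X (\<lambda>x. V x \<bullet> g x)"
    and orth: "(LINT x|X. b x \<bullet> (g x - N x)) = 0" "(LINT x|X. V x \<bullet> g x) = 0"
  shows "(LINT x|X. B x \<bullet> b x + A x \<bullet> S x)
    = (LINT x|X. V x \<bullet> B x) + (LINT x|X. A x \<bullet> S x - P x \<bullet> b x - N x \<bullet> b x + V x \<bullet> P x)"
proof -
  have "integrable X (\<lambda>x. b x \<bullet> (g x - N x))"
    using int by (simp add: inner_diff_right inner_commute)
  moreover have "B x \<bullet> b x + A x \<bullet> S x
      = V x \<bullet> B x + (A x \<bullet> S x - P x \<bullet> b x - N x \<bullet> b x + V x \<bullet> P x) - b x \<bullet> (g x - N x) + V x \<bullet> g x" for x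
    by (simp add: g inner_diff_right inner_diff_left inner_add_left inner_add_right inner_commute)
  ultimately show ?thesis
    using int by (simp add: orth)
qed

text \<open>
  In the following lemmas \<open>\<kappa>\<close> is the Young measure and \<open>V\<close> the strong solution, both taken at a time at
  which the moments of the Young measure are integrable.
\<close>

context
  fixes \<kappa> :: "real ^ 'd \<Rightarrow> (real ^ 'd) measure" and V :: "real ^ 'd \<Rightarrow> real ^ 'd"
  assumes \<kappa>: "\<kappa> \<in> measurable (lebesgue_on torus) (prob_algebra borel)"
    and fin: "AE x in lebesgue_on torus. (\<integral>\<^sup>+ z. ennreal ((norm z)\<^sup>2) \<partial>\<kappa> x) < \<infinity>"
    and int_s: "integrable (lebesgue_on torus) (\<lambda>x. LINT z|\<kappa> x. (norm z)\<^sup>2)"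
    and int_b: "integrable (lebesgue_on torus) (\<lambda>x. barycenter (\<kappa> x))"
    and V: "continuous_on UNIV V"
begin

lemma AE_kernel:
  "AE x in lebesgue_on torus. prob_space (\<kappa> x) \<and> sets (\<kappa> x) = sets borel \<and> (\<integral>\<^sup>+ z. ennreal ((norm z)\<^sup>2) \<partial>\<kappa> x) < \<infinity>"
  using fin AE_space
  by eventually_elim (use measurable_space[OF \<kappa>] in \<open>auto simp: space_prob_algebra\<close>)

lemma integrable_inner_barycenter: "integrable (lebesgue_on torus) (\<lambda>x. barycenter (\<kappa> x) \<bullet> V x)"
  using integrable_inner_continuous_torus[OF int_b V] by (simp add: inner_commute)

lemma integrable_norm_square_field: "integrable (lebesgue_on torus) (\<lambda>x. (norm (V x))\<^sup>2)"
  by (intro integrable_continuous_torus continuous_intros V)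

lemma integrable_variance_field: "integrable (lebesgue_on torus) (\<lambda>x. variance_about (\<kappa> x) (V x))"
  unfolding variance_about_def
  using int_s integrable_inner_barycenter integrable_norm_square_field by simp

lemma integral_variance_field:
  "(LINT x|lebesgue_on torus. variance_about (\<kappa> x) (V x))
    = (LINT x|lebesgue_on torus. LINT z|\<kappa> x. (norm z)\<^sup>2)
      - 2 * (LINT x|lebesgue_on torus. barycenter (\<kappa> x) \<bullet> V x) + (LINT x|lebesgue_on torus. (norm (V x))\<^sup>2)"
  unfolding variance_about_def
  using int_s integrable_inner_barycenter integrable_norm_square_field by simp

lemma AE_variance_field_nonneg: "AE x in lebesgue_on torus. 0 \<le> variance_about (\<kappa> x) (V x)"
  using AE_kernel by eventually_elim (auto intro: variance_about_nonneg)

text \<open>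
  Adding the nonnegative variance about \<open>- V\<close> cancels the mixed term.
\<close>

lemma integral_variance_field_le:
  "(LINT x|lebesgue_on torus. variance_about (\<kappa> x) (V x))
    \<le> 2 * (LINT x|lebesgue_on torus. LINT z|\<kappa> x. (norm z)\<^sup>2) + 2 * (LINT x|lebesgue_on torus. (norm (V x))\<^sup>2)"
proof -
  have "(LINT x|lebesgue_on torus. variance_about (\<kappa> x) (V x))
      \<le> (LINT x|lebesgue_on torus. 2 * (LINT z|\<kappa> x. (norm z)\<^sup>2) + 2 * (norm (V x))\<^sup>2)"
  proof (rule integral_mono_AE[OF integrable_variance_field])
    show "integrable (lebesgue_on torus) (\<lambda>x. 2 * (LINT z|\<kappa> x. (norm z)\<^sup>2) + 2 * (norm (V x))\<^sup>2)"
      using int_s integrable_norm_square_field by simp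
    show "AE x in lebesgue_on torus. variance_about (\<kappa> x) (V x) \<le> 2 * (LINT z|\<kappa> x. (norm z)\<^sup>2) + 2 * (norm (V x))\<^sup>2"
      using AE_kernel
    proof eventually_elim
      case (elim x)
      then have "0 \<le> variance_about (\<kappa> x) (- V x)" by (auto intro: variance_about_nonneg)
      then show ?case by (simp add: variance_about_def)
    qed
  qed
  also have "\<dots> = 2 * (LINT x|lebesgue_on torus. LINT z|\<kappa> x. (norm z)\<^sup>2) + 2 * (LINT x|lebesgue_on torus. (norm (V x))\<^sup>2)"
    using int_s integrable_norm_square_field by simp
  finally show ?thesis .
qed

text \<open>
  The core of the relative energy method: \<open>B\<close> is the time derivative and \<open>A\<close> the gradient of the strong solution,
  and every contribution to the momentum balance that is linear in \<open>z - V\<close> cancels or integrates to zero.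
\<close>

lemma abs_momentum_flux_diff_le:
  fixes A :: "real ^ 'd \<Rightarrow> real ^ 'd ^ 'd" and B :: "real ^ 'd \<Rightarrow> real ^ 'd"
  assumes int_S: "integrable (lebesgue_on torus) (\<lambda>x. second_moment (\<kappa> x))"
    and A: "continuous_on UNIV A" and B: "continuous_on UNIV B"
    and L: "\<And>x. x \<in> torus \<Longrightarrow> norm (A x) \<le> L"
    and g: "\<And>x. g x = - (B x + A x *v V x)"
    and orth: "(LINT x|lebesgue_on torus. barycenter (\<kappa> x) \<bullet> (g x - V x v* A x)) = 0"
      "(LINT x|lebesgue_on torus. V x \<bullet> g x) = 0"
  shows "\<bar>(LINT x|lebesgue_on torus. B x \<bullet> barycenter (\<kappa> x) + A x \<bullet> second_moment (\<kappa> x))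
      - (LINT x|lebesgue_on torus. V x \<bullet> B x)\<bar> \<le> L * (LINT x|lebesgue_on torus. variance_about (\<kappa> x) (V x))"
proof -
  let ?X = "lebesgue_on (torus :: (real ^ 'd) set)"
  let ?P = "\<lambda>x. A x *v V x" and ?N = "\<lambda>x. V x v* A x"
  let ?Q = "\<lambda>x. A x \<bullet> second_moment (\<kappa> x) - ?P x \<bullet> barycenter (\<kappa> x) - ?N x \<bullet> barycenter (\<kappa> x) + V x \<bullet> ?P x"
  have cg: "continuous_on UNIV g"
    unfolding g by (intro continuous_intros A B V)
  have int: "integrable ?X (\<lambda>x. V x \<bullet> B x)" "integrable ?X (\<lambda>x. A x \<bullet> second_moment (\<kappa> x))"
    "integrable ?X (\<lambda>x. ?P x \<bullet> barycenter (\<kappa> x))" "integrable ?X (\<lambda>x. ?N x \<bullet> barycenter (\<kappa> x))"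
    "integrable ?X (\<lambda>x. V x \<bullet> ?P x)" "integrable ?X (\<lambda>x. g x \<bullet> barycenter (\<kappa> x))" "integrable ?X (\<lambda>x. V x \<bullet> g x)"
    by (intro integrable_inner_continuous_torus int_S int_b integrable_continuous_torus continuous_intros A B V cg)+
  have eq: "(LINT x|?X. B x \<bullet> barycenter (\<kappa> x) + A x \<bullet> second_moment (\<kappa> x)) - (LINT x|?X. V x \<bullet> B x) = (LINT x|?X. ?Q x)"
    using momentum_flux_split[OF g int orth] by simp
  have "\<bar>LINT x|?X. ?Q x\<bar> \<le> (LINT x|?X. \<bar>?Q x\<bar>)"
    by (rule integral_abs_bound)
  also have "\<dots> \<le> (LINT x|?X. L * variance_about (\<kappa> x) (V x))"
  proof (rule integral_mono_AE)
    show "integrable ?X (\<lambda>x. \<bar>?Q x\<bar>)"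
      using int by simp
    show "integrable ?X (\<lambda>x. L * variance_about (\<kappa> x) (V x))"
      using integrable_variance_field by simp
    show "AE x in ?X. \<bar>?Q x\<bar> \<le> L * variance_about (\<kappa> x) (V x)"
      using AE_kernel AE_variance_field_nonneg AE_space
    proof eventually_elim
      case (elim x)
      have "\<bar>?Q x\<bar> \<le> norm (A x) * variance_about (\<kappa> x) (V x)"
        using abs_quadratic_moment_le[of "\<kappa> x" "A x" "V x"] elim
        by (simp add: dot_lmul_matrix inner_commute[of "A x *v V x" "barycenter (\<kappa> x)"])
      also have "\<dots> \<le> L * variance_about (\<kappa> x) (V x)"
        using L[of x] elim by (intro mult_right_mono) (auto simp: space_lebesgue_on)
      finally show ?case .
    qed
  qed
  finally show ?thesis unfolding eq by simp
qed

end

lemma abs_integral_torus_le: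
  fixes f :: "real ^ 'd \<Rightarrow> real"
  assumes "K \<ge> 0" "\<And>x. x \<in> torus \<Longrightarrow> \<bar>f x\<bar> \<le> K"
  shows "\<bar>integral\<^sup>L (lebesgue_on torus) f\<bar> \<le> K * measure (lebesgue_on (torus :: (real ^ 'd) set)) torus"
proof (rule abs_integral_le_bound)
  interpret finite_measure "lebesgue_on (torus :: (real ^ 'd) set)" by (rule finite_measure_torus)
  show "emeasure (lebesgue_on (torus :: (real ^ 'd) set)) (space (lebesgue_on torus))
      \<le> ennreal (measure (lebesgue_on (torus :: (real ^ 'd) set)) torus)"
    by (simp add: emeasure_eq_measure space_lebesgue_on)
qed (use assms in \<open>auto simp: space_lebesgue_on\<close>)

text \<open>
  Almost every slice \<open>m\<^sub>t\<close> vanishes on all Borel sets, and \<open>m E\<close> is the integral in time of the slices of \<open>E\<close>.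
\<close>

lemma disintegrated_measure_eq_0:
  fixes m :: "((real ^ 'd) \<times> real) set \<Rightarrow> real ^ 'd ^ 'd"
  assumes dis: "disintegrates T m mt"
    and tv: "AE t in lebesgue_on {0<..<T}. total_variation borel_torus (mt t) \<le> 0"
    and E: "E \<in> sets (borel_torus_time T)"
  shows "m E = 0"
proof -
  have "has_bochner_integral (lebesgue_on {0<..<T}) (\<lambda>t. mt t ((\<lambda>x. (x, t)) -` E)) (m E)"
    using dis E by (simp add: disintegrates_def)
  then have m: "m E = (LINT t|lebesgue_on {0<..<T}. mt t ((\<lambda>x. (x, t)) -` E))"
    by (simp add: has_bochner_integral_integral_eq)
  have "AE t in lebesgue_on {0<..<T}. mt t ((\<lambda>x. (x, t)) -` E) = 0"
    using tv AE_space
  proof eventually_elim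
    case (elim t)
    then have t: "t \<in> {0<..<T}" by (simp add: space_lebesgue_on)
    have sub: "E \<subseteq> torus \<times> {0..T}" using sets.sets_into_space[OF E] by (simp add: space_restrict_space)
    have "(\<lambda>x. (x, t)) \<in> measurable borel_torus (borel_torus_time T)"
      using t by (intro measurable_restrict_space3) auto
    from measurable_sets[OF this E] have "(\<lambda>x. (x, t)) -` E \<inter> space borel_torus \<in> sets (borel_torus :: (real ^ 'd) measure)" .
    moreover have "(\<lambda>x. (x, t)) -` E \<inter> space borel_torus = (\<lambda>x. (x, t)) -` E"
      using sub by (auto simp: space_restrict_space)
    ultimately have "(\<lambda>x. (x, t)) -` E \<in> sets (borel_torus :: (real ^ 'd) measure)" by simp
    moreover have "mt t {} = 0" using dis t by (simp add: disintegrates_def vector_measure_def)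
    ultimately have "ennreal (norm (mt t ((\<lambda>x. (x, t)) -` E))) \<le> 0"
      using norm_le_total_variation[of _ borel_torus "mt t"] elim(1) by (blast intro: order_trans)
    then show ?case by simp
  qed
  then show ?thesis unfolding m by (rule integral_eq_zero_AE)
qed

section \<open>Weak-strong uniqueness\<close>

theorem theorem3p4:
  fixes T :: real
    and u0 :: "real ^ 'd \<Rightarrow> real ^ 'd"
    and \<nu> :: "(real ^ 'd) \<times> real \<Rightarrow> (real ^ 'd) measure"
    and m :: "((real ^ 'd) \<times> real) set \<Rightarrow> real ^ 'd ^ 'd"
    and D :: "real \<Rightarrow> real"
    and U :: "(real ^ 'd) \<times> real \<Rightarrow> real ^ 'd"
  assumes "T > 0"
    and "dissipative_mv_solution T u0 \<nu> m D"
    and "euler_strong_solution T U"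
    and "\<forall>x\<in>torus. U (x, 0) = u0 x"
  shows "(AE p in lebesgue_on (torus \<times> {0<..<T}). \<nu> p = return borel (U p)) \<and>
         (\<forall>E\<in>sets (borel_torus_time T). m E = 0) \<and>
         (AE t in lebesgue_on {0<..<T}. D t = 0)"
proof -
  let ?X = "lebesgue_on (torus :: (real ^ 'd) set)"
  let ?J = "lebesgue_on {0<..<T}"
  let ?S = "(torus :: (real ^ 'd) set) \<times> {0<..<T}"
  note T = \<open>T > 0\<close> and mv = assms(2) and euler = assms(3) and init = assms(4)
  have C1: "C1_torus_time T U" and div: "\<forall>t\<in>{0..T}. \<forall>x. divergence (\<lambda>y. U (y, t)) x = 0"
    using euler by (auto simp: euler_strong_solution_def)
  note cU = continuous_on_C1_torus_time[OF C1 T] and cA = continuous_on_grad_x[OF C1 T]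
    and cB = continuous_on_dt[OF C1 T] and cg = continuous_on_pressure_gradient[OF C1 T]
  have young: "young_measure T \<nu>"
    and Dm: "D \<in> borel_measurable ?J"
    and Dnn: "AE t in ?J. 0 \<le> D t"
    and divfree: "\<forall>\<psi>. C1_torus \<psi> \<longrightarrow>
        (AE t in ?J. (LINT x|?X. (LINT z|\<nu> (x, t). z) \<bullet> gradient \<psi> x) = 0)"
    and energy: "AE \<tau> in ?J.
        (\<integral>\<^sup>+ x. (\<integral>\<^sup>+ z. ennreal ((norm z)\<^sup>2) \<partial>\<nu> (x, \<tau>)) \<partial>?X) / 2 + ennreal (D \<tau>)
        \<le> (\<integral>\<^sup>+ x. ennreal ((norm (u0 x))\<^sup>2) \<partial>?X) / 2"
    using mv unfolding dissipative_mv_solution_def by - (elim conjE; assumption)+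
  from mv obtain mt C where dis: "disintegrates T m mt" and C: "C \<ge> 0"
    and tv: "AE t in ?J. total_variation borel_torus (mt t) \<le> ennreal (C * D t)"
    and momentum: "AE \<tau> in ?J. \<forall>\<phi>.
           C1_torus_time T \<phi> \<longrightarrow>
           (\<forall>t\<in>{0..T}. \<forall>x. divergence (\<lambda>y. \<phi> (y, t)) x = 0) \<longrightarrow>
           (LINT t|lebesgue_on {0<..<\<tau>}. LINT x|?X.
              dt T \<phi> (x, t) \<bullet> (LINT z|\<nu> (x, t). z)
              + grad_x \<phi> (x, t) \<bullet> (LINT z|\<nu> (x, t). tensor z z))
           + (LINT t|lebesgue_on {0<..<\<tau>}. matrix_integral borel_torus (mt t) (\<lambda>x. grad_x \<phi> (x, t)))
           = (LINT x|?X. (LINT z|\<nu> (x, \<tau>). z) \<bullet> \<phi> (x, \<tau>) - u0 x \<bullet> \<phi> (x, 0))"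
    unfolding dissipative_mv_solution_def by - (elim conjE exE; rule that; assumption)
  note kernel = young_measure_kernel[OF young]
  note meas = moments_measurable[OF kernel]
  define s where "s = (\<lambda>p. LINT z|\<nu> p. (norm z)\<^sup>2)"
  define b where "b = (\<lambda>p. barycenter (\<nu> p))"
  define S where "S = (\<lambda>p. second_moment (\<nu> p))"
  define w where "w = (\<lambda>p. variance_about (\<nu> p) (U p))"
  define q where "q = (\<lambda>p. \<integral>\<^sup>+ z. ennreal ((norm z)\<^sup>2) \<partial>\<nu> p)"
  have Um: "U \<in> borel_measurable (restrict_space borel ?S)"
    by (rule continuous_imp_measurable_torus_time[OF cU])
  have wm: "w \<in> borel_measurable (restrict_space borel ?S)"
    unfolding w_def variance_about_def using meas Um by measurable
  define E0 where "E0 = (LINT x|?X. (norm (U (x, 0)))\<^sup>2)"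
  define vol where "vol = measure ?X torus"
  have vol: "vol \<ge> 0" by (simp add: vol_def)
  have E0: "E0 \<ge> 0" by (simp add: E0_def)
  obtain K where K: "K > 0" "\<And>x t. x \<in> torus \<Longrightarrow> t \<in> {0..T} \<Longrightarrow> norm (U (x, t)) \<le> K"
    using bounded_on_torus_time[OF cU] by blast
  obtain L where L: "L > 0" "\<And>x t. x \<in> torus \<Longrightarrow> t \<in> {0..T} \<Longrightarrow> norm (grad_x U (x, t)) \<le> L"
    using bounded_on_torus_time[OF cA] by blast
  obtain K' where K': "K' > 0" "\<And>x t. x \<in> torus \<Longrightarrow> t \<in> {0..T} \<Longrightarrow> norm (dt T U (x, t)) \<le> K'"
    using bounded_on_torus_time[OF cB] by blast
  have "integrable ?X (\<lambda>x. (norm (U (x, 0)))\<^sup>2)"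
    by (intro integrable_continuous_torus continuous_intros continuous_on_time_slice[OF cU]) (use T in auto)
  then have "(\<integral>\<^sup>+ x. ennreal ((norm (U (x, 0)))\<^sup>2) \<partial>?X) = ennreal E0"
    unfolding E0_def by (rule nn_integral_eq_integral) simp
  moreover have "(\<integral>\<^sup>+ x. ennreal ((norm (u0 x))\<^sup>2) \<partial>?X) = (\<integral>\<^sup>+ x. ennreal ((norm (U (x, 0)))\<^sup>2) \<partial>?X)"
    by (rule nn_integral_cong) (use init in \<open>auto simp: space_lebesgue_on\<close>)
  ultimately have init_energy: "(\<integral>\<^sup>+ x. ennreal ((norm (u0 x))\<^sup>2) \<partial>?X) = ennreal E0" by simp

  have kernel_slice: "(\<lambda>x. \<nu> (x, t)) \<in> measurable ?X (prob_algebra borel)" if "t \<in> {0<..<T}" for t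
    by (rule borel_imp_lebesgue_on[OF measurable_section_fst[OF kernel that]])
  \<comment> \<open>The energy inequality makes the moments integrable over the torus at almost every time.\<close>
  have slice: "AE t in ?J. t \<in> {0<..<T} \<and> 0 \<le> D t \<and> (AE x in ?X. q (x, t) < \<infinity>) \<and> integrable ?X (\<lambda>x. s (x, t))
      \<and> (LINT x|?X. s (x, t)) / 2 + D t \<le> E0 / 2
      \<and> integrable ?X (\<lambda>x. b (x, t)) \<and> integrable ?X (\<lambda>x. S (x, t))"
    using energy Dnn AE_space
  proof eventually_elim
    case (elim t)
    then have t: "t \<in> {0<..<T}" by (simp add: space_lebesgue_on)
    have "(\<integral>\<^sup>+ x. (\<integral>\<^sup>+ z. ennreal ((norm z)\<^sup>2) \<partial>\<nu> (x, t)) \<partial>?X) / 2 + ennreal (D t) \<le> ennreal E0 / 2"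
      using elim(1) unfolding init_energy .
    from integrable_moments[OF finite_measure_torus kernel_slice[OF t] this elim(2) E0]
    show ?case using t elim(2) by (auto simp: q_def s_def b_def S_def)
  qed

  \<comment> \<open>The moving test function \<open>p - |U|\<^sup>2/2\<close> in the weak divergence condition.\<close>
  have orth: "AE t in ?J. (LINT x|?X. b (x, t) \<bullet> (pressure_gradient T U (x, t) - U (x, t) v* grad_x U (x, t))) = 0"
  proof (rule AE_integral_orthogonal_at_time[OF T])
    show "continuous_on (UNIV \<times> {0..T}) (\<lambda>p. pressure_gradient T U p - U p v* grad_x U p)"
      by (intro continuous_intros cg cU cA)
    show "AE t in ?J. integrable ?X (\<lambda>x. b (x, t))"
      by (rule eventually_mono[OF slice]) auto
    fix r assume "r \<in> {0..T}"
    then obtain \<psi> where \<psi>: "C1_torus \<psi>" "\<And>x. gradient \<psi> x = pressure_gradient T U (x, r) - U (x, r) v* grad_x U (x, r)"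
      using bernoulli_test_function[OF T euler] by metis
    show "AE t in ?J. (LINT x|?X. b (x, t) \<bullet> (pressure_gradient T U (x, r) - U (x, r) v* grad_x U (x, r))) = 0"
      using divfree[rule_format, OF \<psi>(1)] unfolding \<psi>(2) b_def barycenter_def .
  qed

  define W where "W = (\<lambda>t. LINT x|?X. w (x, t))"
  define G where "G = (\<lambda>t. LINT x|?X. dt T U (x, t) \<bullet> b (x, t) + grad_x U (x, t) \<bullet> S (x, t))"
  define H where "H = (\<lambda>t. LINT x|?X. U (x, t) \<bullet> dt T U (x, t))"
  define N where "N = (\<lambda>t. matrix_integral borel_torus (mt t) (\<lambda>x. grad_x U (x, t)))"
  define c where "c = 2 * (real CARD('d))\<^sup>2 * L * C"
  have c: "c \<ge> 0" using L C by (simp add: c_def)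
  \<comment> \<open>\<open>W\<close> is twice the kinetic part of the relative energy; the sup bound is what the Gronwall iteration
    starts from.\<close>
  have W: "AE t in ?J. 0 \<le> W t \<and> W t \<le> 2 * E0 + 2 * (K\<^sup>2 * vol)
      \<and> W t = (LINT x|?X. s (x, t)) - 2 * (LINT x|?X. b (x, t) \<bullet> U (x, t)) + (LINT x|?X. (norm (U (x, t)))\<^sup>2)
      \<and> \<bar>G t - H t\<bar> \<le> L * W t \<and> integrable ?X (\<lambda>x. w (x, t)) \<and> (AE x in ?X. 0 \<le> w (x, t))"
    using slice orth
  proof eventually_elim
    case (elim t)
    then have t: "t \<in> {0<..<T}" "t \<in> {0..T}" by auto
    note cont = continuous_on_time_slice[OF _ t(2)]
    have f: "AE x in ?X. (\<integral>\<^sup>+ z. ennreal ((norm z)\<^sup>2) \<partial>\<nu> (x, t)) < \<infinity>"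
      and i_s: "integrable ?X (\<lambda>x. LINT z|\<nu> (x, t). (norm z)\<^sup>2)"
      and ib: "integrable ?X (\<lambda>x. barycenter (\<nu> (x, t)))"
      and iS: "integrable ?X (\<lambda>x. second_moment (\<nu> (x, t)))"
      using elim(1) by (auto simp: q_def s_def b_def S_def)
    note hyps = kernel_slice[OF t(1)] f i_s ib cont[OF cU]
    have nn: "AE x in ?X. 0 \<le> w (x, t)"
      unfolding w_def by (rule AE_variance_field_nonneg[OF hyps])
    then have W0: "0 \<le> W t"
      unfolding W_def by (rule integral_nonneg_AE)
    have "\<bar>LINT x|?X. (norm (U (x, t)))\<^sup>2\<bar> \<le> K\<^sup>2 * vol"
      unfolding vol_def using K(2)[OF _ t(2)] by (intro abs_integral_torus_le) (auto intro: power_mono)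
    then have "(LINT x|?X. (norm (U (x, t)))\<^sup>2) \<le> K\<^sup>2 * vol" by linarith
    moreover have "W t \<le> 2 * (LINT x|?X. s (x, t)) + 2 * (LINT x|?X. (norm (U (x, t)))\<^sup>2)"
      unfolding W_def w_def s_def by (rule integral_variance_field_le[OF hyps])
    ultimately have Wle: "W t \<le> 2 * E0 + 2 * (K\<^sup>2 * vol)"
      using elim(1) by linarith
    have Weq: "W t = (LINT x|?X. s (x, t)) - 2 * (LINT x|?X. b (x, t) \<bullet> U (x, t)) + (LINT x|?X. (norm (U (x, t)))\<^sup>2)"
      unfolding W_def w_def s_def b_def by (rule integral_variance_field[OF hyps])
    have "\<bar>G t - H t\<bar> \<le> L * W t"
      unfolding G_def H_def W_def w_def S_def b_def
    proof (rule abs_momentum_flux_diff_le[OF hyps iS cont[OF cA] cont[OF cB]])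
      show "norm (grad_x U (x, t)) \<le> L" if "x \<in> torus" for x using L(2)[OF that t(2)] .
      show "pressure_gradient T U (x, t) = - (dt T U (x, t) + grad_x U (x, t) *v U (x, t))" for x
        by (simp add: pressure_gradient_def)
      show "(LINT x|?X. barycenter (\<nu> (x, t)) \<bullet> (pressure_gradient T U (x, t) - U (x, t) v* grad_x U (x, t))) = 0"
        using elim(2) by (simp add: b_def)
      show "(LINT x|?X. U (x, t) \<bullet> pressure_gradient T U (x, t)) = 0"
        by (rule integral_velocity_pressure_gradient[OF T euler t(2)])
    qed
    moreover have "integrable ?X (\<lambda>x. w (x, t))"
      unfolding w_def by (rule integrable_variance_field[OF hyps])
    ultimately show ?case using W0 Wle Weq nn by blast
  qed
  have Nle: "AE t in ?J. \<bar>N t\<bar> \<le> c * D t"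
    using tv Dnn AE_space
  proof eventually_elim
    case (elim t)
    then have t: "t \<in> {0<..<T}" by (simp add: space_lebesgue_on)
    have "\<bar>N t\<bar> \<le> 2 * (real CARD('d))\<^sup>2 * L * (C * D t)"
      unfolding N_def
    proof (rule abs_matrix_integral_le[OF elim(1)])
      show "0 \<le> C * D t" "0 \<le> L" using C L elim(2) by auto
      show "mt t {} = 0" using dis t by (simp add: disintegrates_def vector_measure_def)
      show "norm (grad_x U (x, t)) \<le> L" if "x \<in> space (borel_torus :: (real ^ 'd) measure)" for x
        using L(2)[of x t] that t by (simp add: space_restrict_space)
    qed
    then show ?case by (simp add: c_def mult.assoc)
  qed

  define e where "e = (\<lambda>t. W t / 2 + D t)"
  \<comment> \<open>\<open>k\<close> satisfies \<open>L W + c D \<le> k (W / 2 + D)\<close> for nonnegative \<open>W\<close> and \<open>D\<close>.\<close>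
  define k where "k = 2 * L + c"
  have Wm: "W \<in> borel_measurable ?J"
    unfolding W_def by (intro borel_imp_lebesgue_on borel_measurable_integral_section wm) auto
  have Gm: "G \<in> borel_measurable ?J"
  proof -
    have "(\<lambda>p. dt T U p \<bullet> b p + grad_x U p \<bullet> S p) \<in> borel_measurable (restrict_space borel ?S)"
      using meas continuous_imp_measurable_torus_time[OF cA] continuous_imp_measurable_torus_time[OF cB]
      unfolding b_def S_def by measurable
    then show ?thesis
      unfolding G_def by (intro borel_imp_lebesgue_on borel_measurable_integral_section) auto
  qed
  have Hm: "H \<in> borel_measurable ?J"
  proof -
    have "(\<lambda>p. U p \<bullet> dt T U p) \<in> borel_measurable (restrict_space borel ?S)"
      using Um continuous_imp_measurable_torus_time[OF cB] by measurable
    then show ?thesis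
      unfolding H_def by (intro borel_imp_lebesgue_on borel_measurable_integral_section) auto
  qed
  have fJ: "finite_measure ?J"
    by (rule finite_measure_lebesgue_on_borel) (use T in auto)
  interpret J: finite_measure ?J by (rule fJ)
  have intW: "integrable ?J W"
    by (rule J.integrable_const_bound[where B = "2 * E0 + 2 * (K\<^sup>2 * vol)", OF _ Wm])
      (rule eventually_mono[OF W], auto)
  have intD: "integrable ?J D"
  proof (rule J.integrable_const_bound[where B = "E0 / 2", OF _ Dm])
    show "AE t in ?J. norm (D t) \<le> E0 / 2"
      using slice
    proof eventually_elim
      case (elim t)
      have "0 \<le> (LINT x|?X. s (x, t))" by (simp add: s_def)
      with elim show ?case by simp
    qed
  qed
  have intH: "integrable ?J H"
  proof (rule J.integrable_const_bound[where B = "K * K' * vol", OF _ Hm], rule eventually_mono[OF AE_space])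
    fix t assume "t \<in> space ?J"
    then have t: "t \<in> {0..T}" by (simp add: space_lebesgue_on)
    have "\<bar>U (x, t) \<bullet> dt T U (x, t)\<bar> \<le> K * K'" if "x \<in> torus" for x
      using K(2)[OF that t] K'(2)[OF that t] K(1)
      by (intro order_trans[OF Cauchy_Schwarz_ineq2] mult_mono) auto
    then show "norm (H t) \<le> K * K' * vol"
      unfolding H_def vol_def real_norm_def using K(1) K'(1) by (intro abs_integral_torus_le) auto
  qed
  have intG: "integrable ?J G"
  proof (rule Bochner_Integration.integrable_bound[OF _ Gm])
    show "integrable ?J (\<lambda>t. \<bar>H t\<bar> + L * W t)" using intH intW by simp
    show "AE t in ?J. norm (G t) \<le> norm (\<bar>H t\<bar> + L * W t)"
      by (rule eventually_mono[OF W]) auto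
  qed

  have gronwall: "AE \<tau> in ?J. e \<tau> \<le> k * (LINT t|lebesgue_on {0<..<\<tau>}. e t)"
    using momentum slice W
  proof eventually_elim
    case (elim \<tau>)
    then have \<tau>: "\<tau> \<in> {0<..<T}" by auto
    then have sub: "{0<..<\<tau>} \<subseteq> {0<..<T}" by auto
    let ?I = "lebesgue_on {0<..<\<tau>}"
    note int_sub = integrable_lebesgue_on_subset[OF _ sub]
    have i: "integrable ?I G" "integrable ?I H" "integrable ?I W" "integrable ?I D"
      using intG intH intW intD by (auto intro!: int_sub)
    have "(LINT t|?I. G t) + (LINT t|?I. N t)
        = (LINT x|?X. b (x, \<tau>) \<bullet> U (x, \<tau>) - u0 x \<bullet> U (x, 0))"
      using elim(1)[rule_format, OF C1] div
      unfolding G_def N_def b_def S_def barycenter_def second_moment_def by blast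
    also have "\<dots> = (LINT x|?X. b (x, \<tau>) \<bullet> U (x, \<tau>) - (norm (U (x, 0)))\<^sup>2)"
      by (rule Bochner_Integration.integral_cong)
        (use init in \<open>auto simp: space_lebesgue_on power2_norm_eq_inner\<close>)
    also have "\<dots> = (LINT x|?X. b (x, \<tau>) \<bullet> U (x, \<tau>)) - E0"
      unfolding E0_def
    proof (rule Bochner_Integration.integral_diff)
      show "integrable ?X (\<lambda>x. b (x, \<tau>) \<bullet> U (x, \<tau>))"
        using integrable_inner_continuous_torus[of "\<lambda>x. b (x, \<tau>)" "\<lambda>x. U (x, \<tau>)"] elim(2)
          continuous_on_time_slice[OF cU, of \<tau>] \<tau> by (auto simp: inner_commute)
      show "integrable ?X (\<lambda>x. (norm (U (x, 0)))\<^sup>2)" by fact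
    qed
    finally have weak: "(LINT t|?I. G t) + (LINT t|?I. N t) = (LINT x|?X. b (x, \<tau>) \<bullet> U (x, \<tau>)) - E0" .
    have kin: "(LINT t|?I. H t) = (LINT x|?X. (norm (U (x, \<tau>)))\<^sup>2) / 2 - E0 / 2"
      unfolding H_def E0_def by (rule kinetic_energy_difference[OF T C1 \<tau>])
    have "(LINT x|?X. s (x, \<tau>)) / 2 + D \<tau> \<le> E0 / 2" using elim(2) by simp
    then have "e \<tau> \<le> - ((LINT t|?I. G t) - (LINT t|?I. H t)) - (LINT t|?I. N t)"
      using elim(3) weak kin unfolding e_def by argo
    also have "\<dots> \<le> \<bar>LINT t|?I. G t - H t\<bar> + \<bar>LINT t|?I. N t\<bar>"
      using i by simp
    also have "\<bar>LINT t|?I. G t - H t\<bar> \<le> (LINT t|?I. L * W t)"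
    proof (rule order_trans[OF integral_abs_bound integral_mono_AE])
      show "AE t in ?I. \<bar>G t - H t\<bar> \<le> L * W t"
        by (rule AE_lebesgue_on_subset[OF _ sub], rule eventually_mono[OF W]) auto
    qed (use i in auto)
    \<comment> \<open>If \<open>N\<close> is not integrable in time, its integral has the default value \<open>0\<close> in the momentum equation
      as well, so the estimate persists.\<close>
    also have "\<bar>LINT t|?I. N t\<bar> \<le> (LINT t|?I. c * D t)"
    proof (cases "integrable ?I N")
      case True
      have "AE t in ?I. \<bar>N t\<bar> \<le> c * D t"
        by (rule AE_lebesgue_on_subset[OF Nle sub]) auto
      then show ?thesis
        using True i by (intro order_trans[OF integral_abs_bound integral_mono_AE]) auto
    next
      case False
      have "AE t in ?I. 0 \<le> c * D t"
        by (rule AE_lebesgue_on_subset[OF _ sub], rule eventually_mono[OF Dnn]) (use c in auto)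
      then have "0 \<le> (LINT t|?I. c * D t)" by (rule integral_nonneg_AE)
      then show ?thesis using False by (simp add: not_integrable_integral_eq)
    qed
    also have "(LINT t|?I. L * W t) + (LINT t|?I. c * D t) = (LINT t|?I. L * W t + c * D t)"
      using i by simp
    also have "\<dots> \<le> (LINT t|?I. k * e t)"
    proof (rule integral_mono_AE)
      have "AE t in ?I. 0 \<le> W t" "AE t in ?I. 0 \<le> D t"
        by (rule AE_lebesgue_on_subset[OF _ sub], rule eventually_mono[OF W], auto)
          (rule AE_lebesgue_on_subset[OF Dnn sub], auto)
      then show "AE t in ?I. L * W t + c * D t \<le> k * e t"
      proof eventually_elim
        case (elim t)
        have "k * e t - (L * W t + c * D t) = c / 2 * W t + 2 * L * D t"
          by (simp add: k_def e_def field_simps)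
        moreover have "0 \<le> c / 2 * W t + 2 * L * D t"
          using elim c L by simp
        ultimately show ?case by linarith
      qed
    qed (use i in \<open>auto simp: e_def\<close>)
    finally show ?case by simp
  qed
  have e_zero: "AE t in ?J. e t = 0"
  proof (rule gronwall_AE[OF _ _ _ gronwall])
    show "k > 0" using L c by (simp add: k_def)
    show "e \<in> borel_measurable ?J" unfolding e_def using Wm Dm by measurable
    show "AE t in ?J. 0 \<le> e t \<and> e t \<le> (2 * E0 + 2 * (K\<^sup>2 * vol)) / 2 + E0 / 2"
      using slice W
    proof eventually_elim
      case (elim t)
      have "0 \<le> (LINT x|?X. s (x, t))" by (simp add: s_def)
      then show ?case using elim unfolding e_def by argo
    qed
  qed
  have zero: "AE t in ?J. W t = 0 \<and> D t = 0"
    using e_zero slice W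
  proof eventually_elim
    case (elim t)
    then have "0 \<le> W t" "0 \<le> D t" by blast+
    moreover have "W t / 2 + D t = 0" using elim(1) by (simp add: e_def)
    ultimately show ?case by linarith
  qed
  then have D0: "AE t in ?J. D t = 0"
    by (rule eventually_mono) simp
  have "AE t in ?J. total_variation borel_torus (mt t) \<le> 0"
    using tv D0 by eventually_elim simp
  then have m0: "\<forall>E\<in>sets (borel_torus_time T). m E = 0"
    using disintegrated_measure_eq_0[OF dis] by blast

  have "AE p in lebesgue_on ?S. q p < \<infinity> \<and> w p = 0"
  proof (rule AE_lebesgue_on_Times)
    have "q \<in> borel_measurable (restrict_space borel ?S)"
      unfolding q_def by (rule meas)
    then have "{p \<in> space (restrict_space borel ?S). \<not> (q p < \<infinity> \<and> w p = 0)} \<in> sets (restrict_space borel ?S)"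
      using wm by measurable
    then show "{p \<in> ?S. \<not> (q p < \<infinity> \<and> w p = 0)} \<in> sets borel"
      by (subst (asm) sets_restrict_space_iff) (auto simp: space_restrict_space borel_Times)
    show "AE t in ?J. AE x in ?X. q (x, t) < \<infinity> \<and> w (x, t) = 0"
      using zero slice W
    proof eventually_elim
      case (elim t)
      then have "AE x in ?X. w (x, t) = 0"
        using integral_nonneg_eq_0_iff_AE[of ?X "\<lambda>x. w (x, t)"] by (simp add: W_def)
      with elim(2) show ?case by auto
    qed
  qed auto
  then have "AE p in lebesgue_on ?S. \<nu> p = return borel (U p)"
    using AE_space
  proof eventually_elim
    case (elim p)
    then have "p \<in> space (restrict_space borel ?S)" by (simp add: space_restrict_space)
    from measurable_space[OF kernel this] show ?case
      using elim eq_return_if_variance_about_eq_0[of "\<nu> p" "U p"]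
      by (auto simp: space_prob_algebra q_def w_def)
  qed
  with m0 D0 show ?thesis by blast
qed

end
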